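(* There exists a constant $C > 1$ such that the following holds. Let $m \in \mathbb{N}$ and $\varepsilon > 0$, and suppose $$\frac{C \log (1/\varepsilon)}{\sqrt{\varepsilon^3 m}} \le p \le 1/2.$$ Let $A \subseteq \mathbb{N}$ be a $p$-random subset. Then $$\Pr\Big( \big| \mathbb{N} \setminus (A+A) \big| \ge m \Big) < (1-p)^{m/2 - \varepsilon m}.$$
   Context: $\mathbb{N} = \{1,2,3,\dots\}$. For $A \subseteq \mathbb{N}$, $A + A = \{a+b : a, b \in A\}$. A $p$-random subset of a countable set $X$ is obtained by including each element of $X$ independently with probability $p$. All logarithms are base 2.
   Formalization: The formal theorem additionally assumes p > 0; for ε ≥ 1 the stated lower bound would admit p = 0, where A is empty and both sides equal 1, so the strict inequality fails (for ε < 1 the bound already forces p > 0). *)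

theory Defs
  imports "HOL-Probability.Probability" "HOL-Library.Set_Algebras"
begin

text \<open>
  A sample point assigns to every \<^term>\<open>x \<in> X\<close> the outcome of an independent coin that shows
  \<^const>\<open>True\<close> with probability \<open>p\<close>. Outside \<open>X\<close> a sample point carries the junk value
  \<^const>\<open>undefined\<close>, so the random set has to be read off with \<open>selected X\<close>.
\<close>

definition random_subset_space :: "real \<Rightarrow> 'a set \<Rightarrow> ('a \<Rightarrow> bool) measure" where
  "random_subset_space p X = (\<Pi>\<^sub>M x\<in>X. measure_pmf (bernoulli_pmf p))"

definition selected :: "'a set \<Rightarrow> ('a \<Rightarrow> bool) \<Rightarrow> 'a set" where
  "selected X \<omega> = {x \<in> X. \<omega> x}"

text \<open>\<^const>\<open>card\<close> is \<open>0\<close> on infinite sets, so these are counted explicitly as large.\<close>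

definition card_at_least :: "nat \<Rightarrow> 'a set \<Rightarrow> bool" where
  "card_at_least m S \<longleftrightarrow> infinite S \<or> m \<le> card S"

interpretation random_subset: prob_space "random_subset_space p X"
  unfolding random_subset_space_def
  by (intro prob_space_PiM prob_space_measure_pmf)

lemma prob_selected:
  assumes "0 \<le> p" "p \<le> 1" "x \<in> X"
  shows "\<P>(\<omega> in random_subset_space p X. x \<in> selected X \<omega>) = p"
proof -
  let ?N = "measure_pmf (bernoulli_pmf p)"
  let ?M = "random_subset_space p X"
  have "p = measure (distr ?M ?N (\<lambda>\<omega>. \<omega> x)) {True}"
    using assms distr_PiM_component[of X "\<lambda>_. ?N" x]
    by (simp add: random_subset_space_def prob_space_measure_pmf measure_pmf_single)
  also have "\<dots> = measure ?M ((\<lambda>\<omega>. \<omega> x) -` {True} \<inter> space ?M)"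
    using assms(3) by (subst measure_distr) (auto simp: random_subset_space_def)
  also have "(\<lambda>\<omega>. \<omega> x) -` {True} \<inter> space ?M = {\<omega> \<in> space ?M. x \<in> selected X \<omega>}"
    using assms(3) by (auto simp: selected_def)
  finally show ?thesis by simp
qed

lemma indep_selected:
  "random_subset.indep_events p X (\<lambda>x. {\<omega> \<in> space (random_subset_space p X). x \<in> selected X \<omega>}) X"
proof -
  let ?N = "measure_pmf (bernoulli_pmf p)"
  have "random_subset.indep_vars p X (\<lambda>_. ?N) (\<lambda>x \<omega>. \<omega> x) X"
  proof (cases "X = {}")
    case True
    then show ?thesis
      by (simp add: random_subset.indep_vars_def random_subset.indep_sets_def)
  next
    case False
    have "distr (Pi\<^sub>M X (\<lambda>_. ?N)) (Pi\<^sub>M X (\<lambda>_. ?N)) (\<lambda>\<omega>. restrict \<omega> X) =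
          distr (Pi\<^sub>M X (\<lambda>_. ?N)) (Pi\<^sub>M X (\<lambda>_. ?N)) (\<lambda>\<omega>. \<omega>)"
      by (rule distr_cong) (auto simp: space_PiM PiE_def extensional_restrict)
    also have "\<dots> = Pi\<^sub>M X (\<lambda>x. distr (Pi\<^sub>M X (\<lambda>_. ?N)) ?N (\<lambda>\<omega>. \<omega> x))"
      by (subst distr_id, rule PiM_cong)
         (auto intro!: distr_PiM_component[where M = "\<lambda>_. ?N", symmetric] prob_space_measure_pmf)
    finally show ?thesis
      using False unfolding random_subset_space_def
      by (subst prob_space.indep_vars_iff_distr_eq_PiM')
         (auto intro!: prob_space_PiM prob_space_measure_pmf measurable_component_singleton)
  qed
  then have "random_subset.indep_events p X (\<lambda>x. {\<omega> \<in> space (random_subset_space p X). \<omega> x}) X"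
    by (rule random_subset.indep_eventsI_indep_vars) simp
  then show ?thesis
    unfolding random_subset.indep_events_def_alt
    by (subst (asm) random_subset.indep_sets_cong[OF refl]) (auto simp: selected_def)
qed

lemma sets_sumset_complement [measurable]:
  fixes X :: "nat set"
  shows "{\<omega> \<in> space (random_subset_space p X). card_at_least m (X - (selected X \<omega> + selected X \<omega>))}
           \<in> sets (random_subset_space p X)"
proof -
  let ?M = "random_subset_space p X"
  have [measurable]: "Measurable.pred ?M (\<lambda>\<omega>. a \<in> selected X \<omega>)" for a
  proof (cases "a \<in> X")
    case True
    have "(\<lambda>\<omega>. \<omega> a) \<in> measurable ?M (measure_pmf (bernoulli_pmf p))"
      unfolding random_subset_space_def using True by (rule measurable_component_singleton)
    then have "Measurable.pred ?M (\<lambda>\<omega>. \<omega> a)"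
      by (simp add: measurable_def)
    then show ?thesis
      using True by (simp add: selected_def)
  qed (simp add: selected_def)
  have *: "card_at_least m S \<longleftrightarrow> (\<exists>F\<in>{F. finite F \<and> card F = m}. \<forall>x\<in>F. x \<in> S)" for S :: "nat set"
  proof
    show "\<exists>F\<in>{F. finite F \<and> card F = m}. \<forall>x\<in>F. x \<in> S" if "card_at_least m S"
    proof (cases "finite S")
      case True
      with that obtain F where "F \<subseteq> S" "card F = m" "finite F"
        by (metis card_at_least_def obtain_subset_with_card_n)
      then show ?thesis by blast
    next
      case False
      then obtain F where "F \<subseteq> S" "card F = m" "finite F"
        by (metis infinite_arbitrarily_large)
      then show ?thesis by blast
    qed
    show "card_at_least m S" if "\<exists>F\<in>{F. finite F \<and> card F = m}. \<forall>x\<in>F. x \<in> S"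
    proof -
      from that obtain F where "finite F" "card F = m" "F \<subseteq> S" by blast
      then show ?thesis unfolding card_at_least_def using card_mono by blast
    qed
  qed
  have "countable {F :: nat set. finite F \<and> card F = m}"
    by (rule countable_subset[OF _ countable_Collect_finite]) auto
  moreover have "Measurable.pred ?M (\<lambda>\<omega>. x \<in> X - (selected X \<omega> + selected X \<omega>))" for x
  proof -
    have "(\<lambda>\<omega>. x \<in> X - (selected X \<omega> + selected X \<omega>)) =
          (\<lambda>\<omega>. x \<in> X \<and> \<not> (\<exists>a. \<exists>b. a \<in> selected X \<omega> \<and> b \<in> selected X \<omega> \<and> x = a + b))"
      by (auto simp: set_plus_def fun_eq_iff)
    then show ?thesis by simp
  qed
  then have "Measurable.pred ?M (\<lambda>\<omega>. \<forall>x\<in>F. x \<in> X - (selected X \<omega> + selected X \<omega>))" for F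
    by (intro pred_intros_countable_bounded) auto
  ultimately have "{\<omega> \<in> space ?M. \<exists>F\<in>{F. finite F \<and> card F = m}.
      \<forall>x\<in>F. x \<in> X - (selected X \<omega> + selected X \<omega>)} \<in> sets ?M"
    by (intro sets.sets_Collect_countable_Ex') (auto simp: pred_def)
  then show ?thesis
    by (simp only: *)
qed

end

theory Submission
  imports Defs
begin

text \<open>
  The elements of the random set \<open>A\<close> are exposed one at a time, in an adaptively chosen order. If the
  strategy always ends with \<open>n\<close> negative answers, or with a proof that few sums are missing, and
  uses at most \<open>t\<close> positive answers, then the event has probability about
  \<open>(1 - p)^n\<close> times a factor \<open>\<kappa>^t\<close>; so \<open>t\<close> has to be \<open>o(\<epsilon> p m / log (1/\<epsilon>))\<close>.

  Let \<open>T\<close> be the set of positive answers. As long as fewer than \<open>n = (1/2 - \<epsilon>/2) m\<close> answers are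
  negative, each \<open>y \<ge> 2 n + g\<close> has at least \<open>g\<close> representations by elements not yet excluded. A
  query \<open>x\<close> such that \<open>x + T\<close> hits many uncovered \<open>y\<close> covers these if the answer is positive; if
  there is none, some query \<open>x\<close> occurs in many representations and prepares later
  queries of the first kind. A potential function shows that \<open>O(m / sqrt g)\<close> positive answers
  reduce the number of uncovered \<open>y\<close> by a constant factor; taking \<open>g\<close> from \<open>m\<close> down to \<open>\<epsilon> m\<close> in
  dyadic steps costs \<open>t = O(sqrt (m/\<epsilon>))\<close>. Sums between \<open>32 m\<close> and order \<open>m/p\<close> are treated by the
  same game in dyadic blocks, where a constant fraction of the block may be excluded, and larger
  ones by a union bound.
\<close>

section \<open>Games of adaptive queries\<close>

text \<open>Both sides count the pairs \<open>(x, t)\<close> with \<open>x + t = y\<close>.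
  Subtraction on naturals truncates; \<open>0 \<notin> R\<close> makes \<open>y - t \<in> R\<close>
  imply \<open>t < y\<close>, so no false pair enters.\<close>

lemma sum_card_representations:
  fixes R T Y :: "nat set"
  assumes "finite R" "finite T" "finite Y" "0 \<notin> R"
  shows "(\<Sum>x\<in>R. card {t\<in>T. x + t \<in> Y}) = (\<Sum>y\<in>Y. card {t\<in>T. y - t \<in> R})"
proof -
  have "(\<Sum>x\<in>R. card {t\<in>T. x + t \<in> Y}) = card (SIGMA x:R. {t\<in>T. x + t \<in> Y})"
    using assms by simp
  also have "\<dots> = card (SIGMA y:Y. {t\<in>T. y - t \<in> R})"
    by (rule bij_betw_same_card[of "\<lambda>(x, t). (x + t, t)"],
        rule bij_betwI[where g = "\<lambda>(y, t). (y - t, t)"])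
       (use assms(4) in \<open>auto split: if_splits\<close>, (metis add.commute diff_is_0_eq' le_add_diff_inverse nat_le_linear)+)
  also have "\<dots> = (\<Sum>y\<in>Y. card {t\<in>T. y - t \<in> R})"
    using assms by simp
  finally show ?thesis .
qed

lemma div_diff_1: "a / d \<le> b / d - 1" if "a \<le> b - d" "0 < d" for a b d :: real
  using that by (simp add: field_simps)

text \<open>\<open>F T D\<close> stands for the conditional probability of the bad event once
  \<open>T\<close> is known to be selected and \<open>D\<close> to be excluded. Only the trivial
  bound and averaging over the next answer are kept, so strategies are analysed without measure
  theory.\<close>

locale query_game =
  fixes p :: real and F :: "nat set \<Rightarrow> nat set \<Rightarrow> real"
  assumes p_pos: "0 < p" and p_less_1: "p < 1"
    and F_le_1: "\<lbrakk>finite T; finite D; T \<subseteq> {1..}; D \<subseteq> {1..}; T \<inter> D = {}\<rbrakk> \<Longrightarrow> F T D \<le> 1"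
    and F_query: "\<lbrakk>finite T; finite D; T \<subseteq> {1..}; D \<subseteq> {1..}; T \<inter> D = {}; 1 \<le> x; x \<notin> T; x \<notin> D\<rbrakk>
      \<Longrightarrow> F T D \<le> p * F (insert x T) D + (1 - p) * F T (insert x D)"
begin

text \<open>A positive answer uses up one unit of the exponent of \<open>\<kappa>\<close>, a
  negative one uses up one factor \<open>\<rho>\<close>. The relation for \<open>\<rho>\<close>
  makes the two branches add up exactly; the excess of \<open>\<rho>\<close> over
  \<open>1 - p\<close> shrinks as \<open>\<kappa>\<close> grows.\<close>

lemma query_step:
  fixes \<kappa> \<rho> c a b :: real
  assumes "1 \<le> \<kappa>" "0 < \<rho>" "1 - p = \<rho> * (1 - p / \<kappa>)" "a \<le> c - 1" "b \<le> c" "card D < n"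
    and state: "finite T" "finite D" "T \<subseteq> {1..}" "D \<subseteq> {1..}" "T \<inter> D = {}" "1 \<le> x" "x \<notin> T" "x \<notin> D"
    and yes: "F (insert x T) D \<le> \<kappa> powr a * \<rho> ^ (n - card D)"
    and no: "F T (insert x D) \<le> \<kappa> powr b * \<rho> ^ (n - card (insert x D))"
  shows "F T D \<le> \<kappa> powr c * \<rho> ^ (n - card D)"
proof -
  define k where "k = n - Suc (card D)"
  have k: "n - card D = Suc k" "n - card (insert x D) = k"
    using assms by (auto simp: k_def)
  have "F T D \<le> p * F (insert x T) D + (1 - p) * F T (insert x D)"
    using state by (rule F_query)
  also have "p * F (insert x T) D \<le> p * (\<kappa> powr (c - 1) * \<rho> ^ Suc k)"
  proof (rule mult_left_mono)
    have "\<kappa> powr a \<le> \<kappa> powr (c - 1)"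
      using assms by (intro powr_mono) auto
    then show "F (insert x T) D \<le> \<kappa> powr (c - 1) * \<rho> ^ Suc k"
      using yes assms(2) unfolding k by (meson mult_right_mono order_trans zero_le_power less_imp_le)
  qed (use p_pos in simp)
  also have "(1 - p) * F T (insert x D) \<le> (1 - p) * (\<kappa> powr c * \<rho> ^ k)"
  proof (rule mult_left_mono)
    have "\<kappa> powr b \<le> \<kappa> powr c"
      using assms by (intro powr_mono) auto
    then show "F T (insert x D) \<le> \<kappa> powr c * \<rho> ^ k"
      using no assms(2) unfolding k by (meson mult_right_mono order_trans zero_le_power less_imp_le)
  qed (use p_less_1 in simp)
  also have "p * (\<kappa> powr (c - 1) * \<rho> ^ Suc k) + (1 - p) * (\<kappa> powr c * \<rho> ^ k) = \<kappa> powr c * \<rho> ^ Suc k"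
  proof -
    have "\<kappa> powr (c - 1) = \<kappa> powr c / \<kappa>"
      using assms(1) by (simp add: powr_diff)
    then show ?thesis
      unfolding assms(3) by (simp add: field_simps)
  qed
  finally show ?thesis
    unfolding k by simp
qed

text \<open>
  \<open>R\<close> are the elements not queried yet, \<open>Y\<close> the uncovered targets, and \<open>T'\<close> the positive answers to
  queries of the second kind in the current stage. \<open>W\<close> counts pairs \<open>x + t = y\<close>, and \<open>r\<close> bounds the
  pairs at each \<open>x\<close>. The truncation at \<open>s\<close> bounds the loss in \<open>W\<close> when \<open>y\<close> gets covered,
  which the term \<open>s * card Y\<close> pays for; \<open>r * card R\<close> pays for negative answers.
\<close>
lemma stage_potential:
  fixes V Ys :: "nat set" and n r s :: nat and \<kappa> \<rho> c g u d :: real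
  defines "R \<equiv> \<lambda>T D. V - T - D"
    and "Y \<equiv> \<lambda>T. Ys - (T + T)"
  defines "W \<equiv> \<lambda>T T' D. \<Sum>y\<in>Y T. min s (card {t\<in>T'. y - t \<in> R T D})"
  defines "\<Phi> \<equiv> \<lambda>T T' D. (real r * card (R T D) + real s * card (Y T) - W T T' D) / d + card (Y T) / r"
  assumes \<kappa>: "1 \<le> \<kappa>" "0 < \<rho>" "1 - p = \<rho> * (1 - p / \<kappa>)" and c: "0 \<le> c"
    and V: "finite V" "V \<subseteq> {1..}" and Ys: "finite Ys"
    and pairs: "\<And>D y. \<lbrakk>D \<subseteq> V; card D < n; y \<in> Ys\<rbrakk> \<Longrightarrow> g \<le> card {x\<in>V - D. y - x \<in> V - D \<and> y \<noteq> x + x}"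
    and par: "1 \<le> r" "1 \<le> s" "0 < u" "0 < g" "2 * real r * card V \<le> s * u" "8 * real r * card V \<le> u * g"
      "0 < d" "4 * card V * d \<le> u * g"
    and won: "\<And>T D. \<lbrakk>T \<subseteq> V; D \<subseteq> V; T \<inter> D = {}; card D \<le> n; card (Ys - (T + T)) < u\<rbrakk>
      \<Longrightarrow> F T D \<le> \<kappa> powr c * \<rho> ^ (n - card D)"
  shows "\<lbrakk>T \<subseteq> V; D \<subseteq> V; T \<inter> D = {}; card D \<le> n; T' \<subseteq> T;
      \<And>x. x \<in> R T D \<Longrightarrow> card {t\<in>T'. x + t \<in> Y T} \<le> r\<rbrakk>
    \<Longrightarrow> F T D \<le> \<kappa> powr (c + \<Phi> T T' D) * \<rho> ^ (n - card D)"
\<comment> \<open>Either answer to a query removes its element from \<open>R\<close>, so the game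
  terminates.\<close>
proof (induction "card (R T D)" arbitrary: T T' D rule: less_induct)
  case less
  note state = less.prems(1-5) and inv = less.prems(6)
  have fin: "finite T" "finite D" "finite T'" "finite (R T D)" "finite (Y T)"
    using finite_subset[OF state(1) V(1)] finite_subset[OF state(2) V(1)] finite_subset[OF state(5)] V(1) Ys
    by (auto simp: R_def Y_def)
  have pos: "T \<subseteq> {1..}" "D \<subseteq> {1..}"
    using state V(2) by auto
  have R0: "0 \<notin> R T D"
    using V(2) by (auto simp: R_def)
  have RV: "card (R T D) \<le> card V"
    by (rule card_mono[OF V(1)]) (auto simp: R_def)
  \<comment> \<open>Double counting turns the bound on the pairs at each \<open>x\<close> into a
    bound on \<open>W\<close>; it keeps \<open>\<Phi>\<close> nonnegative.\<close>
  have W_le: "W T T' D \<le> r * card (R T D)"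
  proof -
    have "W T T' D \<le> (\<Sum>y\<in>Y T. card {t\<in>T'. y - t \<in> R T D})"
      unfolding W_def by (rule sum_mono) simp
    also have "\<dots> = (\<Sum>x\<in>R T D. card {t\<in>T'. x + t \<in> Y T})"
      using fin R0 by (intro sum_card_representations[symmetric])
    also have "\<dots> \<le> (\<Sum>x\<in>R T D. r)"
      by (rule sum_mono) (rule inv)
    finally show ?thesis by (simp add: mult.commute)
  qed
  have \<Phi>_nonneg: "0 \<le> \<Phi> T T' D"
    unfolding \<Phi>_def using par W_le by (intro add_nonneg_nonneg divide_nonneg_pos)
       (auto simp flip: of_nat_mult intro!: add_increasing2)
  \<comment> \<open>The game ends after \<open>n\<close> negative answers, where the trivial bound
    suffices, or with fewer than \<open>u\<close> uncovered targets, where \<open>won\<close>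
    applies. Otherwise a query has to be found.\<close>
  consider "card D = n" | "card (Y T) < u" | "card D < n" "u \<le> card (Y T)"
    using state(4) by linarith
  then show ?case
  proof cases
    case 1
    have "1 \<le> \<kappa> powr (c + \<Phi> T T' D)"
      using \<kappa>(1) c \<Phi>_nonneg by (intro ge_one_powr_ge_zero) auto
    moreover have "F T D \<le> 1"
      using fin pos state by (intro F_le_1)
    ultimately show ?thesis
      using 1 by simp
  next
    case 2
    then have "F T D \<le> \<kappa> powr c * \<rho> ^ (n - card D)"
      using state by (intro won) (auto simp: Y_def)
    also have "\<dots> \<le> \<kappa> powr (c + \<Phi> T T' D) * \<rho> ^ (n - card D)"
      using \<kappa> \<Phi>_nonneg by (intro mult_right_mono powr_mono) auto
    finally show ?thesis .
  next
    case 3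
    \<comment> \<open>It suffices to find \<open>x\<close> whose selection lowers
      \<open>\<Phi>\<close> by 1 and preserves the bound on pairs. A negative answer never raises
      \<open>\<Phi>\<close>: at most \<open>r\<close> pairs are lost at \<open>x\<close>, and
      \<open>r * card R\<close> falls by \<open>r\<close>.\<close>
    have query: ?thesis
      if x: "x \<in> R T D" and T'': "T'' = T' \<or> T'' = insert x T'"
        and inv': "\<And>z. z \<in> R (insert x T) D \<Longrightarrow> card {t\<in>T''. z + t \<in> Y (insert x T)} \<le> r"
        and drop: "\<Phi> (insert x T) T'' D \<le> \<Phi> T T' D - 1" for x T''
    proof -
      have xs: "x \<in> V" "x \<notin> T" "x \<notin> D" "1 \<le> x"
        using x V(2) by (auto simp: R_def)
      have R_yes: "R (insert x T) D = R T D - {x}" and R_no: "R T (insert x D) = R T D - {x}"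
        by (auto simp: R_def)
      have less_R: "card (R T D - {x}) < card (R T D)"
        using x fin(4) by (intro psubset_card_mono) auto
      have "F (insert x T) D \<le> \<kappa> powr (c + \<Phi> (insert x T) T'' D) * \<rho> ^ (n - card D)"
        using xs state T'' less_R inv' by (intro less.hyps) (auto simp: R_yes)
      moreover have "F T (insert x D) \<le> \<kappa> powr (c + \<Phi> T T' (insert x D)) * \<rho> ^ (n - card (insert x D))"
        using xs state less_R inv 3 fin by (intro less.hyps) (auto simp: R_no)
      moreover have "\<Phi> T T' (insert x D) \<le> \<Phi> T T' D"
      proof -
        have "W T T' D \<le> W T T' (insert x D) + r"
        proof -
          have "W T T' D \<le> (\<Sum>y\<in>Y T. min s (card {t\<in>T'. y - t \<in> R T D - {x}}) + card {t\<in>T'. y - t \<in> {x}})"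
            unfolding W_def
          proof (rule sum_mono)
            fix y
            have "{t\<in>T'. y - t \<in> R T D} \<subseteq> {t\<in>T'. y - t \<in> R T D - {x}} \<union> {t\<in>T'. y - t \<in> {x}}"
              by auto
            then have "card {t\<in>T'. y - t \<in> R T D} \<le> card ({t\<in>T'. y - t \<in> R T D - {x}} \<union> {t\<in>T'. y - t \<in> {x}})"
              using fin by (intro card_mono) auto
            also have "\<dots> \<le> card {t\<in>T'. y - t \<in> R T D - {x}} + card {t\<in>T'. y - t \<in> {x}}"
              by (rule card_Un_le)
            finally show "min s (card {t\<in>T'. y - t \<in> R T D})
                \<le> min s (card {t\<in>T'. y - t \<in> R T D - {x}}) + card {t\<in>T'. y - t \<in> {x}}"
              by linarith
          qed
          also have "\<dots> = W T T' (insert x D) + (\<Sum>y\<in>Y T. card {t\<in>T'. y - t \<in> {x}})"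
            by (simp add: W_def R_no sum.distrib)
          also have "(\<Sum>y\<in>Y T. card {t\<in>T'. y - t \<in> {x}}) = (\<Sum>z\<in>{x}. card {t\<in>T'. z + t \<in> Y T})"
            using fin xs by (intro sum_card_representations[symmetric]) auto
          also have "\<dots> \<le> r"
            using inv[OF x] by simp
          finally show ?thesis by simp
        qed
        moreover have "card (R T D) = card (R T (insert x D)) + 1"
          using x fin(4) unfolding R_no by (metis Suc_eq_plus1 card_Suc_Diff1)
        ultimately show ?thesis
          unfolding \<Phi>_def using par(7)
          by (intro add_right_mono divide_right_mono) (auto simp: algebra_simps simp flip: of_nat_add of_nat_mult)
      qed
      ultimately show ?thesis
        using drop
        by (intro query_step[OF \<kappa> _ _ 3(1) fin(1,2) pos state(3) xs(4,2,3),
              where a = "c + \<Phi> (insert x T) T'' D" and b = "c + \<Phi> T T' (insert x D)"]) simp_all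
    qed
    have Y_yes: "Y (insert x T) \<subseteq> Y T" for x
      by (auto simp: Y_def set_plus_def)
    \<comment> \<open>Moving \<open>x\<close> into \<open>T\<close> destroys no pair at a target
      that stays uncovered: \<open>y - t = x\<close> would put \<open>y\<close> into the new
      sumset.\<close>
    have rep_yes: "{t\<in>T'. y - t \<in> R (insert x T) D} = {t\<in>T'. y - t \<in> R T D}"
      if "x \<in> R T D" "y \<in> Y (insert x T)" for x y
    proof -
      have "y - t \<noteq> x" if "t \<in> T'" for t
      proof
        assume "y - t = x"
        moreover have "x \<noteq> 0"
          using \<open>x \<in> R T D\<close> R0 by (metis)
        ultimately have "y = x + t" by simp
        then show False
          using that \<open>y \<in> Y (insert x T)\<close> state(5) by (auto simp: Y_def set_plus_def)
      qed
      then show ?thesis by (auto simp: R_def)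
    qed
    have split_Y: "(\<Sum>y\<in>Y T. f y) \<le> (\<Sum>y\<in>Y (insert x T). f y) + s * (card (Y T) - card (Y (insert x T)))"
      if "\<And>y. f y \<le> s" for x and f :: "nat \<Rightarrow> nat"
    proof -
      have "(\<Sum>y\<in>Y T. f y) = (\<Sum>y\<in>Y T - Y (insert x T). f y) + (\<Sum>y\<in>Y (insert x T). f y)"
        using fin Y_yes by (intro sum.subset_diff)
      moreover have "(\<Sum>y\<in>Y T - Y (insert x T). f y) \<le> (\<Sum>y\<in>Y T - Y (insert x T). s)"
        using that by (intro sum_mono)
      moreover have "card (Y T - Y (insert x T)) = card (Y T) - card (Y (insert x T))"
        using fin Y_yes by (intro card_Diff_subset) (auto intro: finite_subset)
      ultimately show ?thesis by (simp add: mult.commute)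
    qed
    have card_Y_yes: "card (Y (insert x T)) \<le> card (Y T)" for x
      using fin Y_yes by (intro card_mono)
    have R_yes: "card (R (insert x T) D) \<le> card (R T D)" for x
      using fin by (intro card_mono) (auto simp: R_def)
    \<comment> \<open>The test uses all of \<open>T\<close>, not only \<open>T'\<close>: if it fails, few representations of targets involve
      an element of \<open>T\<close>, so most of the \<open>g\<close> representations lie within \<open>R\<close>.\<close>
    show ?thesis
    proof (cases "\<exists>x\<in>R T D. r \<le> card {t\<in>T. x + t \<in> Y T}")
      case True
      then obtain x where x: "x \<in> R T D" "r \<le> card {t\<in>T. x + t \<in> Y T}" by blast
      show ?thesis
      proof (rule query[OF x(1) disjI1[OF refl]])
        fix z assume "z \<in> R (insert x T) D"
        then have "z \<in> R T D" by (auto simp: R_def)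
        have "card {t\<in>T'. z + t \<in> Y (insert x T)} \<le> card {t\<in>T'. z + t \<in> Y T}"
          using fin Y_yes by (intro card_mono) auto
        then show "card {t\<in>T'. z + t \<in> Y (insert x T)} \<le> r"
          using inv[OF \<open>z \<in> R T D\<close>] by linarith
      next
        \<comment> \<open>The translates \<open>x + t\<close> are at least \<open>r\<close> distinct
          newly covered targets, so the term \<open>card Y / r\<close> falls by 1.\<close>
        have "r \<le> card ((+) x ` {t\<in>T. x + t \<in> Y T})"
          using x(2) by (simp add: card_image)
        also have "\<dots> \<le> card (Y T - Y (insert x T))"
          using fin by (intro card_mono) (auto simp: Y_def set_plus_def)
        also have "\<dots> = card (Y T) - card (Y (insert x T))"
          using fin Y_yes by (intro card_Diff_subset) (auto intro: finite_subset)
        finally have "card (Y (insert x T)) + r \<le> card (Y T)"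
          using card_Y_yes[of x] par(1) by linarith
        then have 1: "real (card (Y (insert x T))) / r \<le> card (Y T) / r - 1"
          using par(1) by (simp add: field_simps flip: of_nat_add)
        have "W T T' D \<le> W (insert x T) T' D + s * (card (Y T) - card (Y (insert x T)))"
          unfolding W_def using rep_yes[OF x(1)]
          by (intro order_trans[OF split_Y[of _ x]]) (auto intro!: sum_mono)
        then have "real (W T T' D) \<le> W (insert x T) T' D + s * (real (card (Y T)) - card (Y (insert x T)))"
          using card_Y_yes[of x] by (simp flip: of_nat_mult of_nat_add of_nat_diff)
        moreover have "real r * card (R (insert x T) D) \<le> real r * card (R T D)"
          using R_yes[of x] by (intro mult_left_mono) auto
        ultimately have "real r * card (R (insert x T) D) + real s * card (Y (insert x T)) - W (insert x T) T' D
            \<le> real r * card (R T D) + real s * card (Y T) - W T T' D"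
          by (simp add: algebra_simps)
        then show "\<Phi> (insert x T) T' D \<le> \<Phi> T T' D - 1"
          using 1 par(7) unfolding \<Phi>_def by (smt (verit) divide_right_mono)
      qed
    next
      case False
      define rep where "rep y = card {t\<in>T'. y - t \<in> R T D}" for y
      \<comment> \<open>Targets below the truncation level; only there does another pair raise
        \<open>W\<close>.\<close>
      define S where "S = {y\<in>Y T. rep y < s}"
      have "\<exists>x\<in>R T D. d \<le> card {y\<in>S. y - x \<in> R T D - {x}}"
      proof (rule ccontr)
        assume "\<not> ?thesis"
        then have small: "card {y\<in>S. y - x \<in> R T D - {x}} < d" if "x \<in> R T D" for x
          using that by force
        \<comment> \<open>Each saturated target contributes \<open>s\<close> to \<open>W\<close>,
          and \<open>W\<close> is at most \<open>r * card V\<close>; hence at most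
          \<open>u / 2\<close> targets are saturated.\<close>
        have "s * card (Y T - S) = (\<Sum>y\<in>Y T - S. s)"
          by simp
        also have "\<dots> = (\<Sum>y\<in>Y T - S. min s (rep y))"
          by (rule sum.cong) (auto simp: S_def)
        also have "\<dots> \<le> W T T' D"
          unfolding W_def rep_def[symmetric] using fin by (intro sum_mono2) auto
        also have "\<dots> \<le> r * card V"
          using W_le RV by (meson mult_le_mono2 order_trans)
        finally have "s * (2 * real (card (Y T - S))) \<le> 2 * real r * card V"
          by (simp flip: of_nat_mult)
        also have "\<dots> \<le> s * u" by (rule par)
        finally have "2 * real (card (Y T - S)) \<le> u"
          using par(2) by (subst (asm) mult_le_cancel_left_pos) auto
        moreover have "card (Y T) = card (Y T - S) + card S"
          using fin by (subst card_Diff_subset) (auto simp: S_def card_mono)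
        ultimately have S_large: "u \<le> 2 * real (card S)"
          using 3 by linarith
        have "g \<le> real (card {x\<in>R T D. y - x \<in> R T D - {x}} + 2 * card {t\<in>T. y - t \<in> R T D})"
          if y: "y \<in> S" for y
        proof -
          have yY: "y \<in> Ys" "y \<notin> T + T"
            using y by (auto simp: S_def Y_def)
          let ?A = "{x\<in>R T D. y - x \<in> R T D - {x}}" and ?B = "{t\<in>T. y - t \<in> R T D}"
          \<comment> \<open>As \<open>y\<close> is uncovered, the two summands are not both in
            \<open>T\<close>. Either both lie in \<open>R\<close>, or exactly one lies in
            \<open>T\<close>; the two orders of the latter case give the factor 2.\<close>
          have "{x\<in>V - D. y - x \<in> V - D \<and> y \<noteq> x + x} \<subseteq> ?A \<union> (?B \<union> (\<lambda>t. y - t) ` ?B)"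
          proof
            fix x assume x: "x \<in> {x\<in>V - D. y - x \<in> V - D \<and> y \<noteq> x + x}"
            then have "y - x \<noteq> 0" using V(2) by force
            then have yx: "y = x + (y - x)" "x = y - (y - x)" by auto
            then have "\<not> (x \<in> T \<and> y - x \<in> T)"
              using yY(2) by (metis set_plus_intro)
            then consider "x \<in> T" "y - x \<in> R T D" | "x \<in> R T D" "y - x \<in> T" | "x \<in> R T D" "y - x \<in> R T D"
              using x by (auto simp: R_def)
            then show "x \<in> ?A \<union> (?B \<union> (\<lambda>t. y - t) ` ?B)"
            proof cases
              case 2
              then have "y - x \<in> ?B" using yx(2) by simp
              then have "y - (y - x) \<in> (\<lambda>t. y - t) ` ?B" by (rule imageI)
              then show ?thesis using yx(2) by simp
            qed (use x yx in auto)
          qed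
          then have "card {x\<in>V - D. y - x \<in> V - D \<and> y \<noteq> x + x} \<le> card (?A \<union> (?B \<union> (\<lambda>t. y - t) ` ?B))"
            using fin by (intro card_mono) auto
          also have "\<dots> \<le> card ?A + (card ?B + card ((\<lambda>t. y - t) ` ?B))"
            by (meson add_mono card_Un_le le_refl order_trans)
          also have "\<dots> \<le> card ?A + 2 * card ?B"
            using card_image_le[of ?B "\<lambda>t. y - t"] fin by simp
          finally show ?thesis
            using pairs[OF state(2) 3(1) yY(1)] by linarith
        qed
        then have "(\<Sum>y\<in>S. g) \<le> (\<Sum>y\<in>S. real (card {x\<in>R T D. y - x \<in> R T D - {x}} + 2 * card {t\<in>T. y - t \<in> R T D}))"
          by (rule sum_mono)
        also have "\<dots> = real ((\<Sum>y\<in>S. card {x\<in>R T D. y - x \<in> R T D - {x}}) + 2 * (\<Sum>y\<in>S. card {t\<in>T. y - t \<in> R T D}))"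
          by (simp add: sum.distrib sum_distrib_left)
        also have "(\<Sum>y\<in>S. card {x\<in>R T D. y - x \<in> R T D - {x}}) = (\<Sum>x\<in>R T D. card {y\<in>S. y - x \<in> R T D - {x}})"
        proof -
          have "(\<Sum>y\<in>S. card {x\<in>R T D. y - x \<in> R T D - {x}})
              = (\<Sum>y\<in>S. \<Sum>x\<in>R T D. if y - x \<in> R T D - {x} then 1 else 0)"
            using fin by (simp add: sum.If_cases Int_def)
          also have "\<dots> = (\<Sum>x\<in>R T D. \<Sum>y\<in>S. if y - x \<in> R T D - {x} then 1 else 0)"
            by (rule sum.swap)
          also have "\<dots> = (\<Sum>x\<in>R T D. card {y\<in>S. y - x \<in> R T D - {x}})"
            using fin by (simp add: sum.If_cases Int_def S_def)
          finally show ?thesis .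
        qed
        also have "real ((\<Sum>x\<in>R T D. card {y\<in>S. y - x \<in> R T D - {x}}) + 2 * (\<Sum>y\<in>S. card {t\<in>T. y - t \<in> R T D}))
            \<le> (\<Sum>x\<in>R T D. real (card {y\<in>S. y - x \<in> R T D - {x}})) + 2 * (real r * card (R T D))"
        proof -
          have "(\<Sum>y\<in>S. card {t\<in>T. y - t \<in> R T D}) \<le> (\<Sum>y\<in>Y T. card {t\<in>T. y - t \<in> R T D})"
            using fin by (intro sum_mono2) (auto simp: S_def)
          also have "\<dots> = (\<Sum>x\<in>R T D. card {t\<in>T. x + t \<in> Y T})"
            using fin R0 by (intro sum_card_representations[symmetric])
          also have "\<dots> \<le> (\<Sum>x\<in>R T D. r)"
            using False by (intro sum_mono) (meson nat_le_linear)
          finally have "(\<Sum>y\<in>S. card {t\<in>T. y - t \<in> R T D}) \<le> r * card (R T D)"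
            by (simp add: mult.commute)
          then show ?thesis by (simp flip: of_nat_mult)
        qed
        \<comment> \<open>The sizes now conflict: the left side is at least
          \<open>u * g / 2\<close>, while the sum is below \<open>card V * d \<le> u * g / 4\<close>
          (or empty) and the last term is at most \<open>u * g / 4\<close>.\<close>
        finally have "card S * g \<le> (\<Sum>x\<in>R T D. real (card {y\<in>S. y - x \<in> R T D - {x}})) + 2 * (real r * card (R T D))"
          by simp
        moreover have "u * g \<le> 2 * card S * g"
          using S_large par by (intro mult_right_mono) auto
        moreover have "real r * card (R T D) \<le> real r * card V" "card (R T D) * d \<le> card V * d"
          using RV par by (auto intro: mult_left_mono mult_right_mono)
        moreover have "(\<Sum>x\<in>R T D. real (card {y\<in>S. y - x \<in> R T D - {x}})) < card (R T D) * d \<or> R T D = {}"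
          using sum_strict_mono[of "R T D" "\<lambda>x. real (card {y\<in>S. y - x \<in> R T D - {x}})" "\<lambda>_. d"] small fin
          by auto
        moreover have "0 < u * g" using par by simp
        ultimately show False
          using par(5,6,8) by (elim disjE) auto
      qed
      then obtain x where x: "x \<in> R T D" "d \<le> card {y\<in>S. y - x \<in> R T D - {x}}" by blast
      have xT: "x \<notin> T'" using x(1) state(5) by (auto simp: R_def)
      show ?thesis
      proof (rule query[OF x(1) disjI2[OF refl]])
        fix z assume "z \<in> R (insert x T) D"
        then have z: "z \<in> R T D" by (auto simp: R_def)
        \<comment> \<open>The failed test leaves fewer than \<open>r\<close> pairs at
          \<open>z\<close>, hence room for one new pair with \<open>x\<close>.\<close>
        have "card {t\<in>insert x T'. z + t \<in> Y (insert x T)} \<le> card (insert x {t\<in>T'. z + t \<in> Y T})"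
          using fin Y_yes[of x] by (intro card_mono) auto
        also have "\<dots> \<le> Suc (card {t\<in>T'. z + t \<in> Y T})"
          using fin by (simp add: card_insert_if)
        also have "card {t\<in>T'. z + t \<in> Y T} \<le> card {t\<in>T. z + t \<in> Y T}"
          using fin state(5) by (intro card_mono) auto
        also have "\<dots> < r" using False z by force
        finally show "card {t\<in>insert x T'. z + t \<in> Y (insert x T)} \<le> r" by simp
      next
        \<comment> \<open>\<open>?e\<close> marks the targets gaining the pair
          \<open>(y - x, x)\<close>. They satisfy \<open>rep y < s\<close>, so the truncation does
          not swallow the gain.\<close>
        let ?e = "\<lambda>y. if y \<in> S \<and> y - x \<in> R T D - {x} then 1 else 0 :: nat"
        have "W T T' D + card {y\<in>S. y - x \<in> R T D - {x}} = (\<Sum>y\<in>Y T. min s (rep y) + ?e y)"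
        proof -
          have "{y\<in>S. y - x \<in> R T D - {x}} = Y T \<inter> {y. y \<in> S \<and> y - x \<in> R T D - {x}}"
            by (auto simp: S_def)
          then show ?thesis
            unfolding W_def rep_def[symmetric] sum.distrib using fin by (simp add: sum.If_cases)
        qed
        also have "\<dots> \<le> (\<Sum>y\<in>Y (insert x T). min s (rep y) + ?e y) + s * (card (Y T) - card (Y (insert x T)))"
          by (rule split_Y) (auto simp: S_def)
        also have "(\<Sum>y\<in>Y (insert x T). min s (rep y) + ?e y) \<le> W (insert x T) (insert x T') D"
          unfolding W_def
        proof (rule sum_mono)
          fix y assume y: "y \<in> Y (insert x T)"
          have R': "R (insert x T) D = R T D - {x}" by (auto simp: R_def)
          have "{t\<in>insert x T'. y - t \<in> R (insert x T) D} =
              (if y - x \<in> R T D - {x} then insert x {t\<in>T'. y - t \<in> R T D} else {t\<in>T'. y - t \<in> R T D})"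
            using rep_yes[OF x(1) y] unfolding R' by auto
          then have "card {t\<in>insert x T'. y - t \<in> R (insert x T) D} =
              (if y - x \<in> R T D - {x} then Suc (rep y) else rep y)"
            using fin xT by (simp add: rep_def)
          then show "min s (rep y) + ?e y \<le> min s (card {t\<in>insert x T'. y - t \<in> R (insert x T) D})"
            by (auto simp: S_def)
        qed
        finally have "real (W T T' D) + card {y\<in>S. y - x \<in> R T D - {x}}
            \<le> W (insert x T) (insert x T') D + s * (real (card (Y T)) - card (Y (insert x T)))"
          using card_Y_yes[of x] by (simp flip: of_nat_mult of_nat_add of_nat_diff)
        moreover have "real r * card (R (insert x T) D) \<le> real r * card (R T D)"
          using R_yes[of x] by (intro mult_left_mono) auto
        ultimately have "real r * card (R (insert x T) D) + real s * card (Y (insert x T)) - W (insert x T) (insert x T') D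
            \<le> real r * card (R T D) + real s * card (Y T) - W T T' D - d"
          using x(2) by (simp add: algebra_simps)
        then have "(real r * card (R (insert x T) D) + real s * card (Y (insert x T)) - W (insert x T) (insert x T') D) / d
            \<le> (real r * card (R T D) + real s * card (Y T) - W T T' D) / d - 1"
          using par(7) by (rule div_diff_1)
        moreover have "real (card (Y (insert x T))) / r \<le> card (Y T) / r"
          using card_Y_yes[of x] by (intro divide_right_mono) auto
        ultimately show "\<Phi> (insert x T) (insert x T') D \<le> \<Phi> T T' D - 1"
          unfolding \<Phi>_def by linarith
      qed
    qed
  qed
qed

text \<open>Choice of parameters: up to constants the two terms of the potential are
  \<open>r * M / d\<close> and \<open>u / r\<close>. With \<open>d\<close> of order
  \<open>u * g / M\<close> they balance at \<open>r\<close> about \<open>u * sqrt g / M\<close>, and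
  both become of order \<open>M / sqrt g\<close>.\<close>

lemma stage:
  fixes V Ys :: "nat set" and n M :: nat and \<kappa> \<rho> c g u :: real
  assumes \<kappa>: "1 \<le> \<kappa>" "0 < \<rho>" "1 - p = \<rho> * (1 - p / \<kappa>)" and c: "0 \<le> c"
    and V: "V \<subseteq> {1..M}" and Ys: "finite Ys"
    and pairs: "\<And>D y. \<lbrakk>D \<subseteq> V; card D < n; y \<in> Ys\<rbrakk> \<Longrightarrow> g \<le> card {x\<in>V - D. y - x \<in> V - D \<and> y \<noteq> x + x}"
    and g: "64 \<le> g" and u: "real M \<le> u * sqrt g" and M: "1 \<le> M"
    and won: "\<And>T D. \<lbrakk>T \<subseteq> V; D \<subseteq> V; T \<inter> D = {}; card D \<le> n; card (Ys - (T + T)) < u\<rbrakk>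
      \<Longrightarrow> F T D \<le> \<kappa> powr c * \<rho> ^ (n - card D)"
    and state: "T \<subseteq> V" "D \<subseteq> V" "T \<inter> D = {}" "card D \<le> n" "card (Ys - (T + T)) \<le> 4 * u"
  shows "F T D \<le> \<kappa> powr (c + 60 * (M / sqrt g)) * \<rho> ^ (n - card D)"
proof -
  have g8: "8 \<le> sqrt g" using g by (simp add: real_le_rsqrt)
  have gg: "sqrt g * sqrt g = g" using g by simp
  have Mpos: "0 < real M" using M by simp
  have upos: "0 < u"
    using u Mpos g8 by (smt (verit) mult_nonpos_nonneg)
  define q where "q = u * sqrt g / M"
  have q1: "1 \<le> q" using u Mpos by (simp add: q_def)
  define r where "r = nat \<lfloor>q\<rfloor>"
  have r1: "1 \<le> r"
    using q1 by (simp add: r_def le_nat_floor)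
  have r_le: "real r \<le> q"
    using q1 by (simp add: r_def)
  have "q < real r + 1"
    using q1 by (simp add: r_def)
  then have r_ge: "q \<le> 2 * real r"
    using r1 by linarith
  define s where "s = nat \<lceil>2 * real r * M / u\<rceil>"
  define d where "d = u * g / (4 * M)"
  have d: "0 < d" using upos g Mpos by (simp add: d_def)
  have rM: "4 * u \<le> real r * M"
  proof -
    have "u * 8 \<le> u * sqrt g" using upos g8 by simp
    also have "\<dots> = q * M" using Mpos by (simp add: q_def)
    also have "\<dots> \<le> 2 * real r * M" using r_ge by (rule mult_right_mono) simp
    finally show ?thesis by linarith
  qed
  have s_ge: "2 * real r * M / u \<le> s"
    by (simp add: s_def real_nat_ceiling_ge)
  have "0 < 2 * real r * M / u" using r1 Mpos upos by simp
  then have s_pos: "1 \<le> s" using s_ge by linarith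
  have "real s \<le> 2 * real r * M / u + 1"
    using \<open>0 < 2 * real r * M / u\<close> by (simp add: s_def)
  also have "\<dots> \<le> 3 * real r * M / u"
    using rM upos by (simp add: field_simps)
  finally have s_le: "real s * u \<le> 3 * real r * M"
    using upos by (simp add: field_simps)
  have V_card: "card V \<le> M"
    using card_mono[OF _ V] by simp
  have 8: "8 * real r * M \<le> u * g"
  proof -
    have "8 * real r * M \<le> sqrt g * (q * M)"
      using g8 g r_le r1 Mpos by (subst mult.assoc) (intro mult_mono, auto)
    also have "\<dots> = u * g" using Mpos gg by (simp add: q_def)
    finally show ?thesis .
  qed
  define R where "R = (\<lambda>T D. V - T - D)"
  define Y where "Y = (\<lambda>T. Ys - (T + T))"
  define W where "W = (\<lambda>T T' D. \<Sum>y\<in>Y T. min s (card {t\<in>T'. y - t \<in> R T D}))"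
  define \<Phi> where "\<Phi> = (\<lambda>T T' D. (real r * card (R T D) + real s * card (Y T) - W T T' D) / d + card (Y T) / r)"
  \<comment> \<open>A stage starts with \<open>T' = {}\<close>, so the bound on pairs holds
    trivially, whatever \<open>T\<close> is.\<close>
  have "F T D \<le> \<kappa> powr (c + \<Phi> T {} D) * \<rho> ^ (n - card D)"
    unfolding \<Phi>_def W_def R_def Y_def
  proof (rule stage_potential[OF \<kappa> c _ _ Ys pairs r1 s_pos upos _ _ _ d _ won])
    show "finite V" "V \<subseteq> {1..}" using V finite_subset[OF V] by auto
    show "0 < g" using g by simp
    have "2 * real r * card V \<le> 2 * real r * M" using V_card by (intro mult_left_mono) auto
    also have "\<dots> \<le> s * u" using s_ge upos by (simp add: field_simps)
    finally show "2 * real r * card V \<le> s * u" .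
    have "8 * real r * card V \<le> 8 * real r * M" using V_card by (intro mult_left_mono) auto
    then show "8 * real r * card V \<le> u * g" using 8 by linarith
    have "4 * card V * d \<le> 4 * M * d" using V_card d by (intro mult_right_mono) auto
    also have "\<dots> = u * g" using Mpos by (simp add: d_def)
    finally show "4 * card V * d \<le> u * g" .
  qed (use state r1 in auto)
  also have "\<dots> \<le> \<kappa> powr (c + 60 * (M / sqrt g)) * \<rho> ^ (n - card D)"
  proof (intro mult_right_mono powr_mono add_left_mono)
    have R_card: "card (R T D) \<le> M"
    proof -
      have "card (R T D) \<le> card V" using finite_subset[OF V] by (intro card_mono) (auto simp: R_def)
      then show ?thesis using V_card by linarith
    qed
    have Y_card: "card (Y T) \<le> 4 * u" using state(5) by (simp add: Y_def)
    have "real r * card (R T D) \<le> real r * M" using R_card by (intro mult_left_mono) auto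
    moreover have "real s * card (Y T) \<le> real s * (4 * u)" using Y_card by (intro mult_left_mono) auto
    \<comment> \<open>13 is \<open>1 + 4 * 3\<close>: there are at most \<open>4 * u\<close>
      targets, and \<open>s * u \<le> 3 * r * M\<close>.\<close>
    ultimately have "real r * card (R T D) + real s * card (Y T) - W T {} D \<le> 13 * real r * M"
      using s_le by simp
    then have "(real r * card (R T D) + real s * card (Y T) - W T {} D) / d \<le> 13 * real r * M / d"
      using d by (intro divide_right_mono) auto
    also have "\<dots> \<le> 13 * q * M / d"
      using r_le d by (intro divide_right_mono mult_right_mono) auto
    also have "\<dots> = 52 * (M / sqrt g)"
    proof -
      have "13 * q * M / d = 13 * (u * sqrt g) / (u * (sqrt g * sqrt g) / (4 * M))"
        using Mpos gg by (simp add: q_def d_def)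
      also have "\<dots> = 52 * (M / sqrt g)"
        using upos g8 Mpos by (simp add: divide_simps)
      finally show ?thesis .
    qed
    finally have 1: "(real r * card (R T D) + real s * card (Y T) - W T {} D) / d \<le> 52 * (M / sqrt g)" .
    have "card (Y T) / r \<le> 4 * u / (q / 2)"
      using Y_card r_ge r1 q1 upos by (intro frac_le) auto
    also have "\<dots> = 8 * (M / sqrt g)"
      using upos g8 Mpos by (simp add: q_def divide_simps)
    finally show "\<Phi> T {} D \<le> 60 * (M / sqrt g)"
      using 1 unfolding \<Phi>_def by linarith
  qed (use \<kappa>(1,2) in auto)
  finally show ?thesis .
qed

text \<open>The exponents of successive stages add. When the targets change from \<open>Y i\<close>
  to \<open>Y (Suc i)\<close>, \<open>shift\<close> keeps the uncovered ones within the range that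
  \<open>stage\<close> accepts. The induction peels off the first stage, whose \<open>won\<close>
  hypothesis is the bound for the remaining ones.\<close>

lemma stages:
  fixes V :: "nat set" and Y :: "nat \<Rightarrow> nat set" and n M k :: nat and \<kappa> \<rho> :: real and g u :: "nat \<Rightarrow> real"
  assumes \<kappa>: "1 \<le> \<kappa>" "0 < \<rho>" "1 - p = \<rho> * (1 - p / \<kappa>)"
    and V: "V \<subseteq> {1..M}" and M: "1 \<le> M"
    and Y: "\<And>i. i < k \<Longrightarrow> finite (Y (Suc i))"
    and pairs: "\<And>i D y. \<lbrakk>i < k; D \<subseteq> V; card D < n; y \<in> Y (Suc i)\<rbrakk>
      \<Longrightarrow> g (Suc i) \<le> card {x\<in>V - D. y - x \<in> V - D \<and> y \<noteq> x + x}"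
    and g: "\<And>i. i < k \<Longrightarrow> 64 \<le> g (Suc i)"
    and u: "\<And>i. i < k \<Longrightarrow> real M \<le> u (Suc i) * sqrt (g (Suc i))"
    and shift: "\<And>i T. \<lbrakk>i < k; T \<subseteq> V; card (Y i - (T + T)) < u i\<rbrakk> \<Longrightarrow> card (Y (Suc i) - (T + T)) \<le> 4 * u (Suc i)"
    and won: "\<And>T D. \<lbrakk>T \<subseteq> V; D \<subseteq> V; T \<inter> D = {}; card (Y k - (T + T)) < u k\<rbrakk> \<Longrightarrow> F T D \<le> 0"
    and state: "T \<subseteq> V" "D \<subseteq> V" "T \<inter> D = {}" "card D \<le> n" "card (Y 0 - (T + T)) < u 0"
  shows "F T D \<le> \<kappa> powr (\<Sum>i<k. 60 * (M / sqrt (g (Suc i)))) * \<rho> ^ (n - card D)"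
  using Y pairs g u shift won state
proof (induction k arbitrary: Y g u T D)
  case 0
  have "F T D \<le> 0" using 0 by blast
  also have "0 \<le> \<kappa> powr (\<Sum>i<0. 60 * (M / sqrt (g (Suc i)))) * \<rho> ^ (n - card D)"
    using \<kappa>(1,2) by simp
  finally show ?case .
next
  case (Suc k)
  have "F T D \<le> \<kappa> powr ((\<Sum>i<k. 60 * (M / sqrt (g (Suc (Suc i))))) + 60 * (M / sqrt (g (Suc 0)))) * \<rho> ^ (n - card D)"
  proof (rule stage[OF \<kappa> _ V _ _ _ _ M])
    show "0 \<le> (\<Sum>i<k. 60 * (real M / sqrt (g (Suc (Suc i)))))"
    proof (rule sum_nonneg)
      fix i assume "i \<in> {..<k}"
      then show "0 \<le> 60 * (M / sqrt (g (Suc (Suc i))))"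
        using Suc.prems(3)[of "Suc i"] by simp
    qed
    show "card (Y (Suc 0) - (T + T)) \<le> 4 * u (Suc 0)"
      using Suc.prems by auto
    show "F T' D' \<le> \<kappa> powr (\<Sum>i<k. 60 * (M / sqrt (g (Suc (Suc i))))) * \<rho> ^ (n - card D')"
      if "T' \<subseteq> V" "D' \<subseteq> V" "T' \<inter> D' = {}" "card D' \<le> n" "card (Y (Suc 0) - (T' + T')) < u (Suc 0)" for T' D'
      using that Suc.prems(1-6) by (intro Suc.IH[where Y = "\<lambda>i. Y (Suc i)" and u = "\<lambda>i. u (Suc i)"]) auto
  qed (use Suc.prems in auto)
  then show ?case
    by (subst sum.lessThan_Suc_shift) (simp add: add.commute)
qed

end

section \<open>From probabilities to query games\<close>

lemma pred_mem_selected [measurable]: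
  "Measurable.pred (random_subset_space p X) (\<lambda>\<omega>. a \<in> selected X \<omega>)"
proof (cases "a \<in> X")
  case True
  have "(\<lambda>\<omega>. \<omega> a) \<in> measurable (random_subset_space p X) (measure_pmf (bernoulli_pmf p))"
    unfolding random_subset_space_def using True by (rule measurable_component_singleton)
  then have "Measurable.pred (random_subset_space p X) (\<lambda>\<omega>. \<omega> a)"
    by (simp add: measurable_def)
  then show ?thesis
    using True by (simp add: selected_def)
qed (simp add: selected_def)

lemma pred_mem_sumset [measurable]:
  fixes X :: "nat set"
  shows "Measurable.pred (random_subset_space p X) (\<lambda>\<omega>. y \<in> selected X \<omega> + selected X \<omega>)"
proof -
  have "(\<lambda>\<omega>. y \<in> selected X \<omega> + selected X \<omega>) =
      (\<lambda>\<omega>. \<exists>a. \<exists>b. a \<in> selected X \<omega> \<and> b \<in> selected X \<omega> \<and> y = a + b)"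
    by (auto simp: set_plus_def fun_eq_iff)
  then show ?thesis by simp
qed

lemma sets_card_missing [measurable]:
  fixes X Z :: "nat set"
  assumes "finite Z"
  shows "{\<omega> \<in> space (random_subset_space p X). v \<le> real (card (Z - (selected X \<omega> + selected X \<omega>)))}
    \<in> sets (random_subset_space p X)"
proof -
  have "card (Z - (selected X \<omega> + selected X \<omega>)) =
      (\<Sum>y\<in>Z. if y \<in> selected X \<omega> + selected X \<omega> then 0 else 1)" for \<omega> :: "nat \<Rightarrow> bool"
  proof -
    have "Z - B = {x\<in>Z. x \<notin> B}" for B :: "nat set" by auto
    then show ?thesis
      using assms by (simp add: sum.If_cases Int_def)
  qed
  then show ?thesis by simp
qed

lemma prob_selected_pattern:
  assumes "0 \<le> p" "p \<le> 1" and "finite T" "finite D" "T \<subseteq> X" "D \<subseteq> X" "T \<inter> D = {}"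
  shows "\<P>(\<omega> in random_subset_space p X. T \<subseteq> selected X \<omega> \<and> D \<inter> selected X \<omega> = {})
    = p ^ card T * (1 - p) ^ card D"
proof -
  let ?N = "\<lambda>_::'a. measure_pmf (bernoulli_pmf p)"
  interpret product_prob_space ?N X
    by (intro product_prob_spaceI prob_space_measure_pmf)
  have "emeasure (random_subset_space p X) {\<omega> \<in> space (random_subset_space p X). \<forall>i\<in>T \<union> D. \<omega> i \<in> {i \<in> T}}
      = (\<Prod>i\<in>T \<union> D. emeasure (?N i) {i \<in> T})"
    unfolding random_subset_space_def using assms by (intro emeasure_PiM_Collect) auto
  also have "\<dots> = (\<Prod>i\<in>T. emeasure (?N i) {i \<in> T}) * (\<Prod>i\<in>D. emeasure (?N i) {i \<in> T})"
    using assms by (intro prod.union_disjoint)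
  also have "\<dots> = (\<Prod>i\<in>T. ennreal p) * (\<Prod>i\<in>D. ennreal (1 - p))"
  proof (rule arg_cong2[where f = "(*)"])
    show "(\<Prod>i\<in>T. emeasure (?N i) {i \<in> T}) = (\<Prod>i\<in>T. ennreal p)"
      using assms by (intro prod.cong) (auto simp: emeasure_pmf_single)
    show "(\<Prod>i\<in>D. emeasure (?N i) {i \<in> T}) = (\<Prod>i\<in>D. ennreal (1 - p))"
    proof (rule prod.cong)
      fix i assume "i \<in> D"
      then have "i \<notin> T" using assms(7) by blast
      then show "emeasure (?N i) {i \<in> T} = ennreal (1 - p)"
        using assms by (simp add: emeasure_pmf_single)
    qed simp
  qed
  also have "\<dots> = ennreal (p ^ card T * (1 - p) ^ card D)"
    using assms by (simp add: ennreal_power ennreal_mult)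
  finally have "measure (random_subset_space p X) {\<omega> \<in> space (random_subset_space p X). \<forall>i\<in>T \<union> D. \<omega> i \<in> {i \<in> T}}
      = p ^ card T * (1 - p) ^ card D"
    using assms by (simp add: measure_def)
  moreover have "(\<forall>i\<in>T \<union> D. \<omega> i \<in> {i \<in> T}) \<longleftrightarrow> T \<subseteq> selected X \<omega> \<and> D \<inter> selected X \<omega> = {}" for \<omega>
    using assms by (auto simp: selected_def)
  ultimately show ?thesis by simp
qed

text \<open>The conditional probability of \<open>E\<close> after the answers \<open>T\<close>, \<open>D\<close>.\<close>
definition query_value :: "real \<Rightarrow> (nat \<Rightarrow> bool) set \<Rightarrow> nat set \<Rightarrow> nat set \<Rightarrow> real" where
  "query_value p E T D =
     \<P>(\<omega> in random_subset_space p {1..}. T \<subseteq> selected {1..} \<omega> \<and> D \<inter> selected {1..} \<omega> = {} \<and> \<omega> \<in> E)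
       / (p ^ card T * (1 - p) ^ card D)"

text \<open>Deciding whether \<open>x\<close> is selected splits the event into two disjoint parts;
  their normalising factors differ from the old one by \<open>p\<close> and
  \<open>1 - p\<close>.\<close>

lemma query_game_query_value:
  assumes p: "0 < p" "p < 1" and E: "E \<in> sets (random_subset_space p {1..})"
  shows "query_game p (query_value p E)"
proof
  let ?S = "random_subset_space p {1::nat..}"
  have ev: "{\<omega> \<in> space ?S. T \<subseteq> selected {1..} \<omega> \<and> D \<inter> selected {1..} \<omega> = {} \<and> \<omega> \<in> E} \<in> sets ?S" for T D
  proof -
    have "{\<omega> \<in> space ?S. T \<subseteq> selected {1..} \<omega> \<and> D \<inter> selected {1..} \<omega> = {} \<and> \<omega> \<in> E} =
        {\<omega> \<in> space ?S. (\<forall>t\<in>T. t \<in> selected {1..} \<omega>) \<and> (\<forall>t\<in>D. t \<notin> selected {1..} \<omega>)} \<inter> E"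
      by auto
    then show ?thesis using E by auto
  qed
  show "0 < p" "p < 1" by fact+
  fix T D :: "nat set" assume TD: "finite T" "finite D" "T \<subseteq> {1..}" "D \<subseteq> {1..}" "T \<inter> D = {}"
  have "\<P>(\<omega> in ?S. T \<subseteq> selected {1..} \<omega> \<and> D \<inter> selected {1..} \<omega> = {} \<and> \<omega> \<in> E)
      \<le> \<P>(\<omega> in ?S. T \<subseteq> selected {1..} \<omega> \<and> D \<inter> selected {1..} \<omega> = {})"
    using ev[of T D] ev[of T D, THEN sets.sets_into_space]
    by (intro random_subset.finite_measure_mono)
       (auto simp: subset_eq Int_def disjoint_iff intro!: sets.sets_Collect_countable_Ball)
  then show "query_value p E T D \<le> 1"
    using p TD prob_selected_pattern[of p T D "{1..}"] by (simp add: query_value_def)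
  fix x :: nat assume x: "1 \<le> x" "x \<notin> T" "x \<notin> D"
  have "\<P>(\<omega> in ?S. T \<subseteq> selected {1..} \<omega> \<and> D \<inter> selected {1..} \<omega> = {} \<and> \<omega> \<in> E)
      = \<P>(\<omega> in ?S. insert x T \<subseteq> selected {1..} \<omega> \<and> D \<inter> selected {1..} \<omega> = {} \<and> \<omega> \<in> E)
      + \<P>(\<omega> in ?S. T \<subseteq> selected {1..} \<omega> \<and> insert x D \<inter> selected {1..} \<omega> = {} \<and> \<omega> \<in> E)"
    by (subst random_subset.finite_measure_Union[symmetric, OF ev ev])
       (auto intro!: arg_cong[where f = "measure _"])
  then show "query_value p E T D \<le> p * query_value p E (insert x T) D + (1 - p) * query_value p E T (insert x D)"
    using p TD x by (simp add: query_value_def add_divide_distrib)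
qed

lemma query_value_empty:
  "query_value p E {} {} = measure (random_subset_space p {1..}) E"
  if "E \<in> sets (random_subset_space p {1..})"
proof -
  have "{\<omega> \<in> space (random_subset_space p {1..}). \<omega> \<in> E} = E"
    using sets.sets_into_space[OF that] by auto
  then show ?thesis by (simp add: query_value_def)
qed

text \<open>The pairs \<open>{i, y - i}\<close> with \<open>i \<le> k\<close> are disjoint because
  \<open>2 * k < y\<close>. The partner is queried only after a positive answer, so a pair fails
  with weight \<open>(1 - p) + p * (1 - p) = 1 - p\<^sup>2\<close>.\<close>

lemma (in query_game) pairing_bound:
  fixes y k :: nat
  assumes k: "2 * k < y"
    and won: "\<And>T D i. \<lbrakk>i \<in> T; y - i \<in> T; 1 \<le> i; i < y\<rbrakk> \<Longrightarrow> F T D \<le> 0"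
  shows "\<lbrakk>finite T; finite D; T \<subseteq> {1..}; D \<subseteq> {1..}; T \<inter> D = {};
      \<And>i. 1 \<le> i \<Longrightarrow> i \<le> k \<Longrightarrow> i \<notin> T \<union> D \<and> y - i \<notin> T \<union> D\<rbrakk> \<Longrightarrow> F T D \<le> (1 - p\<^sup>2) ^ k"
  using k
proof (induction k arbitrary: T D)
  case 0
  then show ?case by (simp add: F_le_1)
next
  case (Suc k)
  define x where "x = Suc k"
  define x' where "x' = y - x"
  have new: "x \<notin> T" "x \<notin> D" "x' \<notin> T" "x' \<notin> D" "x \<noteq> x'" "1 \<le> x" "1 \<le> x'"
    using Suc.prems(6)[of x] Suc.prems(7) by (auto simp: x_def x'_def)
  have other: "i \<noteq> x" "i \<noteq> x'" "y - i \<noteq> x" "y - i \<noteq> x'" if "1 \<le> i" "i \<le> k" for i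
    using that Suc.prems(7) by (auto simp: x_def x'_def)
  have 2: "F (insert x T) (insert x' D) \<le> (1 - p\<^sup>2) ^ k"
    using Suc.prems new other by (intro Suc.IH) auto
  have 3: "F T (insert x D) \<le> (1 - p\<^sup>2) ^ k"
    using Suc.prems new other by (intro Suc.IH) auto
  have 4: "F (insert x' (insert x T)) D \<le> 0"
    using Suc.prems(7) by (intro won[of x]) (auto simp: x_def x'_def)
  have "F (insert x T) D \<le> p * F (insert x' (insert x T)) D + (1 - p) * F (insert x T) (insert x' D)"
    using Suc.prems new by (intro F_query) auto
  also have "\<dots> \<le> p * 0 + (1 - p) * (1 - p\<^sup>2) ^ k"
    using 2 4 p_pos p_less_1 by (intro add_mono mult_left_mono) auto
  finally have 5: "F (insert x T) D \<le> (1 - p) * (1 - p\<^sup>2) ^ k" by simp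
  have "F T D \<le> p * F (insert x T) D + (1 - p) * F T (insert x D)"
    using Suc.prems new by (intro F_query) auto
  also have "\<dots> \<le> p * ((1 - p) * (1 - p\<^sup>2) ^ k) + (1 - p) * (1 - p\<^sup>2) ^ k"
    using 3 5 p_pos p_less_1 by (intro add_mono mult_left_mono) auto
  also have "\<dots> = (1 - p\<^sup>2) ^ Suc k"
    by (simp add: algebra_simps power2_eq_square)
  finally show ?case .
qed

section \<open>Reducing the number of missing sums\<close>

text \<open>Of the \<open>y - 1\<close> candidates, \<open>D\<close> and its reflection spoil at
  most \<open>n - 1\<close> each and the midpoint one more.\<close>

lemma card_pairs_ge:
  fixes M n y :: nat
  assumes D: "D \<subseteq> {1..M}" "card D < n" and y: "y \<le> M"
  shows "real y - 2 * real n \<le> card {x\<in>{1..M} - D. y - x \<in> {1..M} - D \<and> y \<noteq> x + x}"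
proof -
  let ?A = "{x\<in>{1..M} - D. y - x \<in> {1..M} - D \<and> y \<noteq> x + x}"
  have fin: "finite D" using D(1) finite_subset by blast
  have "{1..<y} \<subseteq> ?A \<union> (D \<union> ((\<lambda>d. y - d) ` D \<union> {y div 2}))"
  proof
    fix x assume x: "x \<in> {1..<y}"
    then have "x = y - (y - x)" by simp
    then have "y - x \<in> D \<Longrightarrow> x \<in> (\<lambda>d. y - d) ` D" by blast
    then show "x \<in> ?A \<union> (D \<union> ((\<lambda>d. y - d) ` D \<union> {y div 2}))"
      using x y by auto
  qed
  then have "card {1..<y} \<le> card (?A \<union> (D \<union> ((\<lambda>d. y - d) ` D \<union> {y div 2})))"
    using fin by (intro card_mono) auto
  also have "\<dots> \<le> card ?A + (card D + (card ((\<lambda>d. y - d) ` D) + card {y div 2}))"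
    by (meson add_mono card_Un_le le_refl order_trans)
  also have "\<dots> \<le> card ?A + (card D + (card D + 1))"
    using card_image_le[OF fin, of "\<lambda>d. y - d"] by simp
  finally show ?thesis
    using D(2) by simp
qed

lemma card_nat_interval_le:
  fixes a b :: real
  assumes "0 \<le> a" "0 \<le> b"
  shows "real (card {y::nat. a \<le> y \<and> y < a + b}) \<le> b + 1"
proof -
  have "{y::nat. a \<le> y \<and> y < a + b} \<subseteq> {nat \<lceil>a\<rceil>..<nat \<lceil>a + b\<rceil>}"
    by (auto simp: less_ceiling_iff nat_le_iff zless_nat_eq_int_zless ceiling_le_iff)
  then have "card {y::nat. a \<le> y \<and> y < a + b} \<le> nat \<lceil>a + b\<rceil> - nat \<lceil>a\<rceil>"
    using card_mono[of "{nat \<lceil>a\<rceil>..<nat \<lceil>a + b\<rceil>}"] by simp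
  moreover have "real (nat \<lceil>a + b\<rceil> - nat \<lceil>a\<rceil>) \<le> b + 1"
    using assms ceiling_mono[of a "a + b"] by (simp add: of_nat_diff nat_mono) linarith
  ultimately show ?thesis by linarith
qed

lemma sum_inverse_sqrt_2_le: "(\<Sum>i<k. 1 / sqrt 2 ^ i) \<le> 4"
proof -
  have "(\<Sum>i<k. 1 / sqrt 2 ^ i) = (\<Sum>i<k. (1 / sqrt 2) ^ i)"
    by (simp add: power_divide)
  also have "\<dots> \<le> (\<Sum>i. (1 / sqrt 2) ^ i)"
    by (intro sum_le_suminf summable_geometric) auto
  also have "\<dots> = 1 / (1 - 1 / sqrt 2)"
    by (rule suminf_geometric) simp
  also have "\<dots> \<le> 4"
  proof -
    have "4 / 3 \<le> sqrt 2" by (rule real_le_rsqrt) (simp add: power2_eq_square)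
    then have "1 / sqrt 2 \<le> 3 / 4" by (simp add: field_simps)
    then have "1 / (1 - 1 / sqrt 2) \<le> 1 / (1 / 4)" by (intro frac_le) auto
    then show ?thesis by simp
  qed
  finally show ?thesis .
qed

section \<open>Strategies for the initial range and for dyadic blocks\<close>

context query_game
begin

text \<open>The \<open>2 * n\<close> smallest sums are given up, and \<open>g\<close> is halved in
  each stage down to \<open>h\<close>, with \<open>u = g\<close>. The costs
  \<open>60 * M / sqrt g\<close> form a geometric series dominated by its last term.\<close>

lemma initial_range:
  fixes M n :: nat and h \<kappa> \<rho> :: real
  assumes \<kappa>: "1 \<le> \<kappa>" "0 < \<rho>" "1 - p = \<rho> * (1 - p / \<kappa>)"
    and M: "1 \<le> M" and n: "1 \<le> n" and h: "64 \<le> h" "M \<le> h * sqrt h"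
    and won: "\<And>T D. \<lbrakk>T \<subseteq> {1..M}; card ({1..M} - (T + T)) < 2 * real n + 2 * h\<rbrakk> \<Longrightarrow> F T D \<le> 0"
  shows "F {} {} \<le> \<kappa> powr (240 * (M / sqrt h)) * \<rho> ^ n"
proof -
  \<comment> \<open>\<open>k\<close> only has to make \<open>Y 0\<close> empty; the final cost does
    not depend on it.\<close>
  obtain k where k: "real M < 2 ^ k"
    using real_arch_pow[of 2 "real M"] by auto
  define g where "g = (\<lambda>i. 2 ^ (k - i) * h)"
  define Y where "Y = (\<lambda>i. {y\<in>{1..M}. 2 * real n + g i \<le> y})"
  have g_half: "g i = 2 * g (Suc i)" if "i < k" for i
    using that by (simp add: g_def Suc_diff_Suc flip: power_Suc)
  have g_k: "g k = h" by (simp add: g_def)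
  have g_ge: "h \<le> g i" for i
    using h(1) by (simp add: g_def mult_le_cancel_right1)
  have "F {} {} \<le> \<kappa> powr (\<Sum>i<k. 60 * (M / sqrt (g (Suc i)))) * \<rho> ^ (n - card ({} :: nat set))"
  proof (rule stages[OF \<kappa> subset_refl M, where Y = Y and u = g and g = g and T = "{}" and D = "{}"])
    show "finite (Y (Suc i))" for i by (simp add: Y_def)
    show "g (Suc i) \<le> card {x\<in>{1..M} - D. y - x \<in> {1..M} - D \<and> y \<noteq> x + x}"
      if "D \<subseteq> {1..M}" "card D < n" "y \<in> Y (Suc i)" for i D y
      using that card_pairs_ge[of D M n y] by (auto simp: Y_def)
    show "64 \<le> g (Suc i)" for i using g_ge[of "Suc i"] h by linarith
    show "real M \<le> g (Suc i) * sqrt (g (Suc i))" for i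
    proof -
      have "h * sqrt h \<le> g (Suc i) * sqrt (g (Suc i))"
        using g_ge[of "Suc i"] h by (intro mult_mono) auto
      then show ?thesis using h by linarith
    qed
    \<comment> \<open>Fewer than \<open>2 * g (Suc i)\<close> old targets remain, and the new ones
      fill an interval of length \<open>g (Suc i)\<close>.\<close>
    show "card (Y (Suc i) - (T + T)) \<le> 4 * g (Suc i)"
      if "i < k" "card (Y i - (T + T)) < g i" for i T
    proof -
      let ?I = "{y::nat. 2 * real n + g (Suc i) \<le> y \<and> y < 2 * real n + g (Suc i) + g (Suc i)}"
      have "finite ?I"
        by (rule finite_subset[of _ "{..nat \<lceil>2 * real n + g (Suc i) + g (Suc i)\<rceil>}"])
           (auto, linarith)
      then have "card (Y (Suc i) - (T + T)) \<le> card ((Y i - (T + T)) \<union> ?I)"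
        by (intro card_mono) (auto simp: Y_def g_half[OF that(1)])
      also have "\<dots> \<le> card (Y i - (T + T)) + card ?I"
        by (rule card_Un_le)
      finally have "real (card (Y (Suc i) - (T + T))) \<le> real (card (Y i - (T + T))) + real (card ?I)"
        by simp
      moreover have "real (card ?I) \<le> g (Suc i) + 1"
        using g_ge[of "Suc i"] h by (intro card_nat_interval_le) auto
      ultimately show ?thesis
        using that(2) g_half[OF that(1)] g_ge[of "Suc i"] h by linarith
    qed
    show "F T D \<le> 0" if "T \<subseteq> {1..M}" "card (Y k - (T + T)) < g k" for T D
    proof (rule won[OF that(1)])
      \<comment> \<open>All sums below \<open>2 * n + h\<close> are counted as missing; fewer than
        \<open>h\<close> others are.\<close>
      have "{1..M} - (T + T) \<subseteq> (Y k - (T + T)) \<union> {1..nat \<lfloor>2 * real n + h\<rfloor>}"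
      proof
        fix y assume y: "y \<in> {1..M} - (T + T)"
        show "y \<in> (Y k - (T + T)) \<union> {1..nat \<lfloor>2 * real n + h\<rfloor>}"
        proof (cases "2 * real n + h \<le> y")
          case False
          then have "y \<le> nat \<lfloor>2 * real n + h\<rfloor>" by (intro le_nat_floor) simp
          then show ?thesis using y by simp
        qed (use y in \<open>auto simp: Y_def g_def\<close>)
      qed
      then have "card ({1..M} - (T + T)) \<le> card ((Y k - (T + T)) \<union> {1..nat \<lfloor>2 * real n + h\<rfloor>})"
        by (intro card_mono) (auto simp: Y_def)
      also have "\<dots> \<le> card (Y k - (T + T)) + card {1..nat \<lfloor>2 * real n + h\<rfloor>}"
        by (rule card_Un_le)
      finally have "real (card ({1..M} - (T + T))) \<le> real (card (Y k - (T + T))) + nat \<lfloor>2 * real n + h\<rfloor>"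
        by simp
      moreover have "real (nat \<lfloor>2 * real n + h\<rfloor>) \<le> 2 * real n + h"
        using h by (intro of_nat_floor) auto
      ultimately show "card ({1..M} - (T + T)) < 2 * real n + 2 * h"
        using that(2) unfolding g_k by linarith
    qed
    have "real M < g 0"
    proof -
      have "1 * 2 ^ k \<le> h * 2 ^ k"
        using h(1) by (intro mult_right_mono) auto
      moreover have "g 0 = h * 2 ^ k" by (simp add: g_def)
      ultimately show ?thesis
        using k by linarith
    qed
    then have "Y 0 = {}" by (auto simp: Y_def)
    then show "card (Y 0 - ({} + {})) < g 0"
      using g_ge[of 0] h by simp
  qed (use n in auto)
  also have "\<dots> \<le> \<kappa> powr (240 * (M / sqrt h)) * \<rho> ^ n"
  proof -
    have "(\<Sum>i<k. 60 * (M / sqrt (g (Suc i)))) = 60 * (M / sqrt h) * (\<Sum>i<k. 1 / sqrt 2 ^ (k - Suc i))"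
      by (simp add: sum_distrib_left g_def real_sqrt_mult real_sqrt_power mult.commute)
    also have "(\<Sum>i<k. 1 / sqrt 2 ^ (k - Suc i)) = (\<Sum>i<k. 1 / sqrt 2 ^ i)"
      by (rule sum.nat_diff_reindex)
    also have "60 * (M / sqrt h) * \<dots> \<le> 60 * (M / sqrt h) * 4"
      using h by (intro mult_left_mono sum_inverse_sqrt_2_le) auto
    finally show ?thesis
      using \<kappa>(1,2) by (simp only: card.empty diff_zero) (intro mult_right_mono powr_mono, auto)
  qed
  finally show ?thesis .
qed

text \<open>Since \<open>8 * n \<le> N\<close>, every target in the upper half keeps at least
  \<open>N / 4\<close> representations throughout. So \<open>g\<close> is constant, and each of the
  \<open>k\<close> stages halves the threshold at cost \<open>120 * sqrt N\<close>.\<close>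

lemma dyadic_block:
  fixes N n k :: nat and v \<kappa> \<rho> :: real
  assumes \<kappa>: "1 \<le> \<kappa>" "0 < \<rho>" "1 - p = \<rho> * (1 - p / \<kappa>)"
    and N: "256 \<le> N" and n: "8 * n \<le> N" and v: "2 * sqrt N \<le> v" and k: "real N < 2 ^ k * v"
    and won: "\<And>T D. \<lbrakk>T \<subseteq> {1..N}; card ({N div 2<..N} - (T + T)) < v\<rbrakk> \<Longrightarrow> F T D \<le> 0"
  shows "F {} {} \<le> \<kappa> powr (120 * k * sqrt N) * \<rho> ^ n"
proof -
  define u where "u = (\<lambda>i. 2 ^ (k - i) * v)"
  have v0: "0 < v" using v N by (smt (verit) of_nat_0_less_iff real_sqrt_gt_0_iff less_le_trans zero_less_numeral)
  have "F {} {} \<le> \<kappa> powr (\<Sum>i<k. 60 * (N / sqrt (N / 4))) * \<rho> ^ (n - card ({} :: nat set))"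
  proof (rule stages[OF \<kappa> subset_refl, where Y = "\<lambda>_. {N div 2<..N}" and u = u and g = "\<lambda>_. N / 4" and M = N and k = k and n = n and T = "{}" and D = "{}"])
    show "N / 4 \<le> card {x\<in>{1..N} - D. y - x \<in> {1..N} - D \<and> y \<noteq> x + x}"
      if "D \<subseteq> {1..N}" "card D < n" "y \<in> {N div 2<..N}" for D y
    proof -
      have "N < 2 * y" "y \<le> N" using that(3) by auto
      then have "real N / 4 \<le> real y - 2 * real n" using n by linarith
      then show ?thesis using card_pairs_ge[OF that(1,2) \<open>y \<le> N\<close>] by linarith
    qed
    show "real N \<le> u (Suc i) * sqrt (N / 4)" for i
    proof -
      have "real N = 2 * sqrt N * sqrt (N / 4)"
        by (simp add: real_sqrt_divide)
      also have "\<dots> \<le> u (Suc i) * sqrt (N / 4)"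
      proof (rule mult_right_mono)
        have "1 * v \<le> u (Suc i)" unfolding u_def using v0 by (intro mult_right_mono) auto
        then show "2 * sqrt N \<le> u (Suc i)" using v by linarith
      qed simp
      finally show ?thesis .
    qed
    show "card ({N div 2<..N} - (T + T)) \<le> 4 * u (Suc i)"
      if "i < k" "card ({N div 2<..N} - (T + T)) < u i" for i T
    proof -
      have "u i = 2 * u (Suc i)"
        using that(1) by (simp add: u_def Suc_diff_Suc flip: power_Suc)
      moreover have "0 < u (Suc i)" using v0 by (simp add: u_def)
      ultimately show ?thesis using that(2) by linarith
    qed
    show "card ({N div 2<..N} - ({} + {})) < u 0"
    proof -
      have "card ({N div 2<..N} - ({} + {})) \<le> card {1..N}"
        by (intro card_mono) auto
      then show ?thesis using k by (simp add: u_def)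
    qed
  qed (use N won in \<open>auto simp: u_def\<close>)
  also have "(\<Sum>i<k. 60 * (N / sqrt (N / 4))) = 120 * k * sqrt N"
  proof -
    have "real N / sqrt (real N / 4) = 2 * (real N / sqrt N)"
      by (simp add: real_sqrt_divide)
    also have "real N / sqrt N = sqrt N"
      by (rule real_div_sqrt) simp
    finally show ?thesis by simp
  qed
  finally show ?thesis by simp
qed

end

section \<open>Probability of many missing sums\<close>

lemma query_value_eq_0:
  assumes "\<And>\<omega>. \<lbrakk>\<omega> \<in> E; T \<subseteq> selected {1..} \<omega>\<rbrakk> \<Longrightarrow> False"
  shows "query_value p E T D = 0"
proof -
  have "{\<omega> \<in> space (random_subset_space p {1..}). T \<subseteq> selected {1..} \<omega> \<and> D \<inter> selected {1..} \<omega> = {} \<and> \<omega> \<in> E} = {}"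
    using assms by blast
  then show ?thesis by (simp only: query_value_def measure_empty div_0)
qed

lemma card_missing_antimono:
  fixes T S Z :: "nat set"
  assumes "T \<subseteq> S" "finite Z"
  shows "card (Z - (S + S)) \<le> card (Z - (T + T))"
  using assms set_plus_mono2[of T S T S] by (intro card_mono) auto

text \<open>Sums covered by the positive answers are covered by the random set. Once fewer than
  \<open>w\<close> are uncovered the event is impossible, which gives the \<open>won\<close>
  hypothesis.\<close>

lemma prob_initial_missing:
  fixes M n :: nat and p h \<kappa> \<rho> w :: real
  assumes p: "0 < p" "p < 1"
    and \<kappa>: "1 \<le> \<kappa>" "0 < \<rho>" "1 - p = \<rho> * (1 - p / \<kappa>)"
    and M: "1 \<le> M" and n: "1 \<le> n" and h: "64 \<le> h" "M \<le> h * sqrt h"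
    and w: "2 * real n + 2 * h \<le> w"
  shows "\<P>(\<omega> in random_subset_space p {1..}. w \<le> card ({1..M} - (selected {1..} \<omega> + selected {1..} \<omega>)))
    \<le> \<kappa> powr (240 * (M / sqrt h)) * \<rho> ^ n"
proof -
  let ?E = "{\<omega> \<in> space (random_subset_space p {1..}). w \<le> card ({1..M} - (selected {1..} \<omega> + selected {1..} \<omega>))}"
  have E: "?E \<in> sets (random_subset_space p {1..})" by (rule sets_card_missing) simp
  interpret query_game p "query_value p ?E"
    by (rule query_game_query_value[OF p E])
  have "query_value p ?E {} {} \<le> \<kappa> powr (240 * (M / sqrt h)) * \<rho> ^ n"
  proof (rule initial_range[OF \<kappa> M n h], rule eq_refl, rule query_value_eq_0)
    fix T \<omega> assume "card ({1..M} - (T + T)) < 2 * real n + 2 * h" "\<omega> \<in> ?E" "T \<subseteq> selected {1..} \<omega>"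
    then show False
      using w card_missing_antimono[of T "selected {1..} \<omega>" "{1..M}"] by auto
  qed
  then show ?thesis by (simp only: query_value_empty[OF E])
qed

lemma prob_dyadic_missing:
  fixes N n k :: nat and p v \<kappa> \<rho> :: real
  assumes p: "0 < p" "p < 1"
    and \<kappa>: "1 \<le> \<kappa>" "0 < \<rho>" "1 - p = \<rho> * (1 - p / \<kappa>)"
    and N: "256 \<le> N" and n: "8 * n \<le> N" and v: "2 * sqrt N \<le> v" and k: "real N < 2 ^ k * v"
  shows "\<P>(\<omega> in random_subset_space p {1..}. v \<le> card ({N div 2<..N} - (selected {1..} \<omega> + selected {1..} \<omega>)))
    \<le> \<kappa> powr (120 * k * sqrt N) * \<rho> ^ n"
proof -
  let ?E = "{\<omega> \<in> space (random_subset_space p {1..}). v \<le> card ({N div 2<..N} - (selected {1..} \<omega> + selected {1..} \<omega>))}"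
  have E: "?E \<in> sets (random_subset_space p {1..})" by (rule sets_card_missing) simp
  interpret query_game p "query_value p ?E"
    by (rule query_game_query_value[OF p E])
  have "query_value p ?E {} {} \<le> \<kappa> powr (120 * k * sqrt N) * \<rho> ^ n"
  proof (rule dyadic_block[OF \<kappa> N n v k], rule eq_refl, rule query_value_eq_0)
    fix T \<omega> assume "card ({N div 2<..N} - (T + T)) < v" "\<omega> \<in> ?E" "T \<subseteq> selected {1..} \<omega>"
    then show False
      using card_missing_antimono[of T "selected {1..} \<omega>" "{N div 2<..N}"] by auto
  qed
  then show ?thesis by (simp only: query_value_empty[OF E])
qed

lemma prob_not_in_sumset_le:
  assumes p: "0 < p" "p < 1" and k: "2 * k < y"
  shows "\<P>(\<omega> in random_subset_space p {1..}. y \<notin> selected {1..} \<omega> + selected {1..} \<omega>) \<le> (1 - p\<^sup>2) ^ k"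
proof -
  let ?E = "{\<omega> \<in> space (random_subset_space p {1..}). y \<notin> selected {1..} \<omega> + selected {1..} \<omega>}"
  have E: "?E \<in> sets (random_subset_space p {1..})" by measurable
  interpret query_game p "query_value p ?E"
    by (rule query_game_query_value[OF p E])
  have "query_value p ?E {} {} \<le> (1 - p\<^sup>2) ^ k"
  proof (rule pairing_bound[OF k], rule eq_refl, rule query_value_eq_0)
    fix T \<omega> i assume "i \<in> T" "y - i \<in> T" "i < y" "\<omega> \<in> ?E" "T \<subseteq> selected {1..} \<omega>"
    then have "i + (y - i) \<in> selected {1..} \<omega> + selected {1..} \<omega>" by blast
    then show False using \<open>\<omega> \<in> ?E\<close> \<open>i < y\<close> by simp
  qed auto
  then show ?thesis by (simp only: query_value_empty[OF E])
qed

text \<open>Union bound over \<open>y\<close>, grouped in twos: both \<open>2 * (q + k) + 1\<close>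
  and \<open>2 * (q + k) + 2\<close> have \<open>q + k\<close> disjoint pairs, which yields one
  geometric series in \<open>k\<close>.\<close>

lemma prob_tail_missing:
  assumes p: "0 < p" "p < 1"
  shows "\<P>(\<omega> in random_subset_space p {1..}. \<exists>y>2 * q. y \<notin> selected {1..} \<omega> + selected {1..} \<omega>)
    \<le> 2 * (1 - p\<^sup>2) ^ q / p\<^sup>2"
proof -
  let ?S = "random_subset_space p {1::nat..}"
  let ?B = "\<lambda>y. {\<omega> \<in> space ?S. y \<notin> selected {1..} \<omega> + selected {1..} \<omega>}"
  let ?A = "\<lambda>k. ?B (2 * (q + k) + 1) \<union> ?B (2 * (q + k) + 2)"
  have A_le: "measure ?S (?A k) \<le> 2 * (1 - p\<^sup>2) ^ q * (1 - p\<^sup>2) ^ k" for k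
  proof -
    have "measure ?S (?A k) \<le> measure ?S (?B (2 * (q + k) + 1)) + measure ?S (?B (2 * (q + k) + 2))"
      by (rule measure_Un_le) measurable
    also have "\<dots> \<le> (1 - p\<^sup>2) ^ (q + k) + (1 - p\<^sup>2) ^ (q + k)"
      using p by (intro add_mono prob_not_in_sumset_le) auto
    finally show ?thesis by (simp add: power_add mult.commute mult.left_commute)
  qed
  have "p\<^sup>2 < 1" using p by (simp add: power_less_one_iff)
  then have x: "norm (1 - p\<^sup>2) < 1" using p by simp
  then have sm: "summable (\<lambda>k. 2 * (1 - p\<^sup>2) ^ q * (1 - p\<^sup>2) ^ k)"
    by (intro summable_mult summable_geometric)
  have sA: "summable (\<lambda>k. measure ?S (?A k))"
    using A_le by (intro summable_comparison_test'[OF sm, of 0]) auto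
  have "{\<omega> \<in> space ?S. \<exists>y>2 * q. y \<notin> selected {1..} \<omega> + selected {1..} \<omega>} \<subseteq> (\<Union>k. ?A k)"
  proof
    fix \<omega> assume "\<omega> \<in> {\<omega> \<in> space ?S. \<exists>y>2 * q. y \<notin> selected {1..} \<omega> + selected {1..} \<omega>}"
    then obtain y where y: "\<omega> \<in> space ?S" "2 * q < y" "y \<notin> selected {1..} \<omega> + selected {1..} \<omega>" by blast
    define k where "k = (y - 2 * q - 1) div 2"
    have "y = 2 * (q + k) + 1 \<or> y = 2 * (q + k) + 2"
      using y(2) unfolding k_def by presburger
    then have "\<omega> \<in> ?A k" using y by auto
    then show "\<omega> \<in> (\<Union>k. ?A k)" by blast
  qed
  then have "measure ?S {\<omega> \<in> space ?S. \<exists>y>2 * q. y \<notin> selected {1..} \<omega> + selected {1..} \<omega>} \<le> measure ?S (\<Union>k. ?A k)"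
    by (intro random_subset.finite_measure_mono) measurable
  also have "\<dots> \<le> (\<Sum>k. measure ?S (?A k))"
    using sA by (intro random_subset.finite_measure_subadditive_countably) auto
  also have "\<dots> \<le> (\<Sum>k. 2 * (1 - p\<^sup>2) ^ q * (1 - p\<^sup>2) ^ k)"
    by (rule suminf_le[OF A_le sA sm])
  also have "\<dots> = 2 * (1 - p\<^sup>2) ^ q / p\<^sup>2"
    using x by (subst suminf_mult) (auto simp: summable_geometric suminf_geometric)
  finally show ?thesis .
qed

lemma card_missing_dyadic_le:
  fixes B :: "nat set"
  shows "card ({1..2 ^ J * K} - B) \<le> card ({1..K} - B) + (\<Sum>j<J. card ({2 ^ j * K<..2 ^ Suc j * K} - B))"
proof (induction J)
  case (Suc J)
  have "{1..2 ^ Suc J * K} - B = ({1..2 ^ J * K} - B) \<union> ({2 ^ J * K<..2 ^ Suc J * K} - B)"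
    by auto
  then have "card ({1..2 ^ Suc J * K} - B) \<le> card ({1..2 ^ J * K} - B) + card ({2 ^ J * K<..2 ^ Suc J * K} - B)"
    by (metis card_Un_le)
  then show ?case using Suc.IH by simp
qed simp

lemma exp_le_one_minus:
  fixes t :: real
  assumes "0 \<le> t" "t \<le> 1 / 2"
  shows "exp (- 2 * t) \<le> 1 - t"
proof -
  have "2 * t\<^sup>2 \<le> t"
    using assms mult_left_mono[of "2 * t" 1 t] by (simp add: power2_eq_square)
  then have "- 2 * t \<le> ln (1 - t)"
    using ln_one_minus_pos_lower_bound[OF assms] by linarith
  then show ?thesis
    using assms by (simp add: ln_ge_iff)
qed

section \<open>Numerical estimates\<close>

text \<open>
  With \<open>a = sqrt \<epsilon>\<close> and \<open>b = sqrt m\<close> all quantities are monomials in \<open>a\<close> and \<open>b\<close>; the denominator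
  \<open>sqrt (\<epsilon>^3 m)\<close> becomes \<open>a^3 b\<close>.
\<close>
locale sumset_parameters =
  fixes m :: nat and p a b l :: real
  assumes p: "0 < p" "p \<le> 1 / 2" and a: "0 < a" "2 * a\<^sup>2 \<le> 1" and b: "b = sqrt (real m)" and m: "1 \<le> m"
    and l: "l = log 2 (1 / a\<^sup>2)"
    and large: "10 ^ 6 * l \<le> p * (a ^ 3 * b)"
begin

lemma l_ge_1: "1 \<le> l"
proof -
  have "log 2 2 \<le> log 2 (1 / a\<^sup>2)"
    using a by (intro log_mono) (auto simp: field_simps)
  then show ?thesis using l by simp
qed

lemma b_ge_1: "1 \<le> b" and b_sq: "b * b = m"
  using m b by auto

lemma a_le_1: "a \<le> 1"
proof -
  have "a\<^sup>2 \<le> 1\<^sup>2" using a by simp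
  then show ?thesis using a(1) by (rule_tac power2_le_imp_le) auto
qed

lemma a3b_ge: "2 * 10 ^ 6 \<le> a ^ 3 * b"
proof -
  have "10 ^ 6 * 1 \<le> 10 ^ 6 * l" using l_ge_1 by simp
  also have "\<dots> \<le> p * (a ^ 3 * b)" by (rule large)
  also have "\<dots> \<le> (1 / 2) * (a ^ 3 * b)" using p a b_ge_1 by (intro mult_right_mono) auto
  finally show ?thesis by simp
qed

lemma a2b_ge: "a ^ 3 * b \<le> a\<^sup>2 * b"
proof -
  have "a ^ 3 \<le> a\<^sup>2"
    using a a_le_1 power_decreasing[of 2 3 a] by auto
  then show ?thesis using b_ge_1 by (auto intro: mult_right_mono)
qed

lemma a2b2_ge: "2 * 10 ^ 6 \<le> a\<^sup>2 * b\<^sup>2"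
proof -
  have "a\<^sup>2 * b * 1 \<le> a\<^sup>2 * b * b" using b_ge_1 by (intro mult_left_mono) auto
  then show ?thesis using a3b_ge a2b_ge by (simp add: power2_eq_square)
qed

text \<open>Here \<open>b / a\<close> is \<open>sqrt (m/\<epsilon>)\<close>, the order of the number
  of positive answers, and \<open>l\<close> the order of the log of \<open>\<kappa>\<close>; the
  right side is \<open>p * \<epsilon> * m\<close>, the order of the available gain.\<close>

lemma large_pa2b2: "10 ^ 6 * l * (b / a) \<le> p * (a\<^sup>2 * b\<^sup>2)"
proof -
  have "10 ^ 6 * l * (b / a) \<le> p * (a ^ 3 * b) * (b / a)"
    using large b_ge_1 a by (intro mult_right_mono) auto
  also have "\<dots> = p * (a\<^sup>2 * b\<^sup>2)"
    using a by (simp add: power2_eq_square power3_eq_cube)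
  finally show ?thesis .
qed

lemma large_pb2: "10 ^ 6 * l * b \<le> p * b\<^sup>2"
proof -
  have "a ^ 3 \<le> 1" using a a_le_1 by (intro power_le_one) auto
  then have "p * (a ^ 3 * b) \<le> p * (1 * b)" using p b_ge_1 by (intro mult_left_mono mult_right_mono) auto
  then have "10 ^ 6 * l \<le> p * b" using large by simp
  then have "10 ^ 6 * l * b \<le> p * b * b" using b_ge_1 by (intro mult_right_mono) auto
  then show ?thesis by (simp add: power2_eq_square)
qed

text \<open>Lets the errors from dyadic blocks and the tail be compared with
  \<open>exp (- p * m)\<close> instead of the target.\<close>

lemma target_ge: "exp (- p * b\<^sup>2) \<le> (1 - p) powr (real m / 2 - a\<^sup>2 * real m)"
proof -
  have "- 2 * p \<le> ln (1 - p)"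
    using exp_le_one_minus[of p] p by (simp add: ln_ge_iff)
  then have "(- 2 * p) * (m / 2 - a\<^sup>2 * m) \<le> ln (1 - p) * (m / 2 - a\<^sup>2 * m)"
  proof (rule mult_right_mono)
    have "a\<^sup>2 * m \<le> 1 / 2 * m" using a by (intro mult_right_mono) auto
    then show "0 \<le> m / 2 - a\<^sup>2 * m" by simp
  qed
  moreover have "- p * m \<le> (- 2 * p) * (m / 2 - a\<^sup>2 * m)"
    using p by (simp add: algebra_simps)
  ultimately have "- p * m \<le> ln (1 - p) * (m / 2 - a\<^sup>2 * m)" by linarith
  then show ?thesis
    using p b_sq by (simp add: powr_def power2_eq_square mult.commute)
qed

text \<open>Budget in units of \<open>p * \<epsilon> * m\<close>: taking \<open>n\<close> about
  \<open>(1/2 - \<epsilon>/2) * m\<close> gains 1/2 in the exponent over the target; with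
  \<open>\<kappa> = 8/\<epsilon>\<close> the factor \<open>(1 - p / \<kappa>) ^ n\<close> in the
  denominator costs 1/8, and the power of \<open>\<kappa>\<close> another 1/8. The remaining 1/4
  beats the factor 4.\<close>

lemma initial_bound:
  "\<P>(\<omega> in random_subset_space p {1..}.
      (1 - a\<^sup>2 / 2) * m \<le> card ({1..32 * m} - (selected {1..} \<omega> + selected {1..} \<omega>)))
    \<le> (1 - p) powr (real m / 2 - a\<^sup>2 * real m) / 4"
proof -
  define n where "n = nat \<lceil>(1 / 2 - a\<^sup>2 / 2) * m\<rceil>"
  define \<kappa> where "\<kappa> = 8 / a\<^sup>2"
  define h where "h = a\<^sup>2 * b\<^sup>2 / 9"
  define \<rho> where "\<rho> = (1 - p) / (1 - p / \<kappa>)"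
  have mb: "real m = b\<^sup>2" using b_sq by (simp add: power2_eq_square)
  have a2: "0 < a\<^sup>2" "a\<^sup>2 \<le> 1 / 2" using a by auto
  have am: "0 \<le> (1 / 2 - a\<^sup>2 / 2) * m" using a2 by (intro mult_nonneg_nonneg) auto
  have n_ge: "(1 / 2 - a\<^sup>2 / 2) * m \<le> n"
    unfolding n_def by (rule real_nat_ceiling_ge)
  have n_le: "n \<le> (1 / 2 - a\<^sup>2 / 2) * m + 1"
    using am unfolding n_def by linarith
  have big: "2 * 10 ^ 6 \<le> a\<^sup>2 * m" using a2b2_ge mb by simp
  have n_half: "n \<le> b\<^sup>2 / 2"
    using n_le big mb by (simp add: algebra_simps)
  have \<kappa>1: "16 \<le> \<kappa>" using a2 by (simp add: \<kappa>_def field_simps)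
  have t: "0 \<le> p / \<kappa>" "p / \<kappa> \<le> 1 / 2"
    using p \<kappa>1 by (auto simp: field_simps)
  have "p / \<kappa> < 1" using t(2) by linarith
  then have nz: "1 - p / \<kappa> \<noteq> 0" by linarith
  have \<rho>: "0 < \<rho>" "1 - p = \<rho> * (1 - p / \<kappa>)"
    using \<open>p / \<kappa> < 1\<close> p iffD1[OF nonzero_eq_divide_eq[OF nz] \<rho>_def] by (simp_all add: \<rho>_def)
  have sqrt_h: "sqrt h = a * b / 3"
    using a b_ge_1 by (simp add: h_def real_sqrt_divide real_sqrt_mult)
  have 1: "\<P>(\<omega> in random_subset_space p {1..}.
      (1 - a\<^sup>2 / 2) * m \<le> card ({1..32 * m} - (selected {1..} \<omega> + selected {1..} \<omega>)))
    \<le> \<kappa> powr (240 * (real (32 * m) / sqrt h)) * \<rho> ^ n"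
  proof (rule prob_initial_missing[OF _ _ _ \<rho>])
    have "0 < (1 / 2 - a\<^sup>2 / 2) * m" using a2 m by (intro mult_pos_pos) auto
    then show "1 \<le> n" using n_ge by linarith
    show "64 \<le> h" using a2b2_ge by (simp add: h_def)
    have "real (32 * m) = 32 * b\<^sup>2" using mb by simp
    also have "\<dots> \<le> (a ^ 3 * b / 27) * b\<^sup>2" using a3b_ge by (intro mult_right_mono) auto
    also have "\<dots> = h * sqrt h" unfolding sqrt_h by (simp add: h_def power2_eq_square power3_eq_cube)
    finally show "real (32 * m) \<le> h * sqrt h" .
    show "2 * real n + 2 * h \<le> (1 - a\<^sup>2 / 2) * m"
      using n_le big mb unfolding h_def by (simp add: algebra_simps)
  qed (use p m \<kappa>1 in auto)
  have 2: "\<kappa> powr (240 * (real (32 * m) / sqrt h)) \<le> exp (p * (a\<^sup>2 * b\<^sup>2) / 8)"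
  proof -
    have "ln \<kappa> = (3 + l) * ln 2"
    proof -
      have "log 2 \<kappa> = log 2 (2 ^ 3) + log 2 (1 / a\<^sup>2)"
        using a2 log_mult[of 2 "2 ^ 3" "1 / a\<^sup>2"] by (simp add: \<kappa>_def)
      also have "\<dots> = 3 + l" by (subst log_pow_cancel) (auto simp: l)
      finally show ?thesis by (simp add: log_def field_simps)
    qed
    also have "\<dots> \<le> (3 + l) * 1" using l_ge_1 ln_2_less_1 by (intro mult_left_mono) auto
    also have "\<dots> \<le> 4 * l" using l_ge_1 by simp
    finally have ln\<kappa>: "ln \<kappa> \<le> 4 * l" .
    have "240 * (real (32 * m) / sqrt h) = 23040 * (b / a)"
      using a b_ge_1 by (simp add: mb sqrt_h field_simps power2_eq_square)
    then have "240 * (real (32 * m) / sqrt h) * ln \<kappa> \<le> 23040 * (b / a) * (4 * l)"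
      using ln\<kappa> a b_ge_1 by (simp only:) (intro mult_left_mono, auto)
    \<comment> \<open>\<open>23040 * 4 * 8 = 737280\<close> has to stay below the constant of the
      theorem.\<close>
    also have "\<dots> \<le> 10 ^ 6 * l * (b / a) / 8"
      using a b_ge_1 l_ge_1 by (simp add: field_simps)
    also have "\<dots> \<le> p * (a\<^sup>2 * b\<^sup>2) / 8"
      using large_pa2b2 by (rule divide_right_mono) simp
    finally show ?thesis using \<kappa>1 by (simp add: powr_def)
  qed
  have 3: "\<rho> ^ n \<le> (1 - p) powr (real m / 2 - a\<^sup>2 * real m) * exp (- p * (a\<^sup>2 * b\<^sup>2) * 3 / 8)"
  proof -
    have "\<rho> ^ n = (1 - p) ^ n / (1 - p / \<kappa>) ^ n"
      by (simp add: \<rho>_def power_divide)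
    also have "\<dots> \<le> ((1 - p) powr (real m / 2 - a\<^sup>2 * real m) * exp (- p * (a\<^sup>2 * b\<^sup>2) / 2)) / exp (- p * (a\<^sup>2 * b\<^sup>2) / 8)"
    proof (rule frac_le)
      have "(1 - p) ^ n = (1 - p) powr n" using p by (simp add: powr_realpow)
      also have "\<dots> \<le> (1 - p) powr ((1 / 2 - a\<^sup>2 / 2) * m)"
        using p n_ge by (intro powr_mono') auto
      also have "(1 / 2 - a\<^sup>2 / 2) * m = (real m / 2 - a\<^sup>2 * real m) + a\<^sup>2 * b\<^sup>2 / 2"
        by (simp add: mb algebra_simps)
      also have "(1 - p) powr \<dots> = (1 - p) powr (real m / 2 - a\<^sup>2 * real m) * (1 - p) powr (a\<^sup>2 * b\<^sup>2 / 2)"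
        by (rule powr_add)
      also have "\<dots> \<le> (1 - p) powr (real m / 2 - a\<^sup>2 * real m) * exp (- p * (a\<^sup>2 * b\<^sup>2) / 2)"
      proof (rule mult_left_mono)
        have "ln (1 - p) \<le> - p" using p ln_le_minus_one[of "1 - p"] by simp
        then have "(a\<^sup>2 * b\<^sup>2 / 2) * ln (1 - p) \<le> (a\<^sup>2 * b\<^sup>2 / 2) * - p"
          by (intro mult_left_mono) auto
        then show "(1 - p) powr (a\<^sup>2 * b\<^sup>2 / 2) \<le> exp (- p * (a\<^sup>2 * b\<^sup>2) / 2)"
          using p by (simp add: powr_def algebra_simps)
      qed simp
      finally show "(1 - p) ^ n \<le> (1 - p) powr (real m / 2 - a\<^sup>2 * real m) * exp (- p * (a\<^sup>2 * b\<^sup>2) / 2)" .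
      have "real n * (- 2 * (p / \<kappa>)) \<ge> b\<^sup>2 / 2 * (- 2 * (p / \<kappa>))"
        using n_half t by (intro mult_right_mono_neg) auto
      then have "exp (- p * (a\<^sup>2 * b\<^sup>2) / 8) \<le> exp (real n * (- 2 * (p / \<kappa>)))"
        using a2 by (simp add: \<kappa>_def mult_ac)
      also have "\<dots> = exp (- 2 * (p / \<kappa>)) ^ n" by (rule exp_of_nat_mult)
      also have "\<dots> \<le> (1 - p / \<kappa>) ^ n"
        using t by (intro power_mono exp_le_one_minus) auto
      finally show "exp (- p * (a\<^sup>2 * b\<^sup>2) / 8) \<le> (1 - p / \<kappa>) ^ n" .
    qed (use p in auto)
    also have "\<dots> = (1 - p) powr (real m / 2 - a\<^sup>2 * real m) * exp (- p * (a\<^sup>2 * b\<^sup>2) * 3 / 8)"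
      by (simp add: exp_diff[symmetric] flip: times_divide_eq_right)
    finally show ?thesis .
  qed
  note 1
  also have "\<kappa> powr (240 * (real (32 * m) / sqrt h)) * \<rho> ^ n
      \<le> exp (p * (a\<^sup>2 * b\<^sup>2) / 8) * ((1 - p) powr (real m / 2 - a\<^sup>2 * real m) * exp (- p * (a\<^sup>2 * b\<^sup>2) * 3 / 8))"
    using 2 3 \<rho>(1) by (intro mult_mono) auto
  also have "exp (p * (a\<^sup>2 * b\<^sup>2) / 8) * ((1 - p) powr (real m / 2 - a\<^sup>2 * real m) * exp (- p * (a\<^sup>2 * b\<^sup>2) * 3 / 8))
      = (1 - p) powr (real m / 2 - a\<^sup>2 * real m) * exp (- (p * (a\<^sup>2 * b\<^sup>2) / 4))"
    by (simp add: exp_add[symmetric] mult.left_commute flip: exp_add)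
  also have "\<dots> \<le> (1 - p) powr (real m / 2 - a\<^sup>2 * real m) * (1 / 4)"
  proof (rule mult_left_mono)
    have "10 ^ 6 * 1 * 1 \<le> 10 ^ 6 * l * (b / a)"
      using l_ge_1 b_ge_1 a a_le_1 by (intro mult_mono) (auto simp: field_simps)
    then have "4 \<le> p * (a\<^sup>2 * b\<^sup>2) / 4" using large_pa2b2 by simp
    then have "4 \<le> exp (p * (a\<^sup>2 * b\<^sup>2) / 4)"
      using exp_ge_add_one_self[of "p * (a\<^sup>2 * b\<^sup>2) / 4"] by linarith
    then show "exp (- (p * (a\<^sup>2 * b\<^sup>2) / 4)) \<le> 1 / 4"
      by (simp add: exp_minus field_simps)
  qed simp
  finally show ?thesis by simp
qed

end

text \<open>Absorbs the linear growth in \<open>j\<close> of the number of stages for block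
  \<open>j\<close>.\<close>

lemma sqrt_2_power_ge: "1 + real j / 3 \<le> sqrt 2 ^ j"
proof -
  have "4 / 3 \<le> sqrt 2" by (rule real_le_rsqrt) (simp add: power2_eq_square)
  then have "1 + j * (sqrt 2 - 1) \<ge> 1 + j * (1 / 3)"
    by (intro add_left_mono mult_left_mono) auto
  then show ?thesis
    using Bernoulli_inequality[of "sqrt 2 - 1" j] by simp
qed

section \<open>Dyadic blocks, tail and final union bound\<close>

context sumset_parameters
begin

text \<open>The thresholds decay geometrically, so that all blocks together allow at most
  \<open>\<epsilon> * m / 2\<close> missing sums. As \<open>n\<close> is \<open>N / 8\<close>, far
  above \<open>m / 2\<close>, the fixed value \<open>\<kappa> = 4\<close> is good enough: cost 2
  against gain 6 in units of \<open>2 ^ j * p * m\<close>.\<close>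

lemma dyadic_bound:
  assumes j: "2 ^ j * p \<le> 1"
  shows "\<P>(\<omega> in random_subset_space p {1..}.
      a\<^sup>2 * b\<^sup>2 / 8 / sqrt 2 ^ j \<le>
        card ({2 ^ j * (32 * m)<..2 ^ Suc j * (32 * m)} - (selected {1..} \<omega> + selected {1..} \<omega>)))
    \<le> exp (- 4 * 2 ^ j * (p * b\<^sup>2))"
proof -
  define N where "N = 2 ^ Suc j * (32 * m)"
  define n where "n = 8 * 2 ^ j * m"
  define s where "s = sqrt 2 ^ j"
  define v where "v = a\<^sup>2 * b\<^sup>2 / 8 / s"
  \<comment> \<open>\<open>2 ^ k\<close> is at least \<open>2048 * 4 ^ j / \<epsilon>\<close>, which
    exceeds \<open>N / v\<close>.\<close>
  define k where "k = 11 + 2 * j + nat \<lceil>l\<rceil>"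
  define \<rho> where "\<rho> = (1 - p) / (1 - p / 4)"
  have mb: "real m = b\<^sup>2" using b_sq by (simp add: power2_eq_square)
  have s1: "1 \<le> s" by (simp add: s_def)
  have ss: "s * s = 2 ^ j" by (simp add: s_def flip: power_mult_distrib)
  have \<rho>: "0 < \<rho>" "1 - p = \<rho> * (1 - p / 4)"
    using p by (simp_all add: \<rho>_def)
  have "real N = (8 * s * b)\<^sup>2"
    using ss by (simp add: N_def mb power2_eq_square mult_ac)
  then have sqrt_N: "sqrt N = 8 * s * b"
    using s1 b_ge_1 by simp
  have "\<P>(\<omega> in random_subset_space p {1..}. v \<le> card ({N div 2<..N} - (selected {1..} \<omega> + selected {1..} \<omega>)))
      \<le> 4 powr (120 * k * sqrt N) * \<rho> ^ n"
  proof (rule prob_dyadic_missing[OF _ _ _ \<rho>])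
    have "b \<le> real m" using b_ge_1 b_sq mult_left_mono[of 1 b b] by simp
    moreover have "2 * 10 ^ 6 \<le> b"
    proof -
      have "a ^ 3 * b \<le> 1 * b" using a a_le_1 b_ge_1 by (intro mult_right_mono power_le_one) auto
      then show ?thesis using a3b_ge by simp
    qed
    ultimately have "256 \<le> real m" by simp
    then have "256 \<le> m" by linarith
    moreover have "m * 1 \<le> m * (2 ^ Suc j * 32)" by (intro mult_left_mono) auto
    moreover have "N = m * (2 ^ Suc j * 32)" by (simp add: N_def)
    ultimately show "256 \<le> N" by linarith
    show "8 * n \<le> N" by (simp add: n_def N_def)
    show "2 * sqrt N \<le> v"
    proof -
      \<comment> \<open>The assumption \<open>2 ^ j * p \<le> 1\<close> enters here: in later blocks
        \<open>v\<close> might fall below \<open>2 * sqrt N\<close>.\<close>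
      have "10 ^ 6 * 2 ^ j * p \<le> 10 ^ 6 * 1"
        using j by simp
      also have "\<dots> \<le> 10 ^ 6 * l" using l_ge_1 by simp
      also have "\<dots> \<le> (a ^ 3 * b) * p" using large by (simp add: mult.commute)
      finally have "10 ^ 6 * 2 ^ j \<le> a ^ 3 * b" using p by simp
      then have "128 * (s * s) \<le> a\<^sup>2 * b"
      proof -
        have "128 * 2 ^ j \<le> 10 ^ 6 * (2::real) ^ j" by simp
        also note \<open>10 ^ 6 * 2 ^ j \<le> a ^ 3 * b\<close>
        also note a2b_ge
        finally show ?thesis unfolding ss .
      qed
      then have "128 * (s * s) * b \<le> a\<^sup>2 * b * b" using b_ge_1 by (intro mult_right_mono) auto
      then show ?thesis
        using s1 by (simp add: sqrt_N v_def field_simps power2_eq_square)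
    qed
    show "real N < 2 ^ k * v"
    proof -
      have "2 powr l = 1 / a\<^sup>2" using a l by simp
      moreover have "2 powr l \<le> 2 powr real (nat \<lceil>l\<rceil>)"
        by (intro powr_mono real_nat_ceiling_ge) auto
      ultimately have "1 / a\<^sup>2 \<le> 2 ^ nat \<lceil>l\<rceil>"
        by (simp add: powr_realpow)
      then have "2048 * 4 ^ j * (1 / a\<^sup>2) \<le> 2048 * 4 ^ j * 2 ^ nat \<lceil>l\<rceil>"
        by (intro mult_left_mono) auto
      also have "\<dots> = 2 ^ k" by (simp add: k_def power_add power_mult)
      finally have "2048 * 4 ^ j * (1 / a\<^sup>2) * v \<le> 2 ^ k * v"
        using a b_ge_1 s1 by (intro mult_right_mono) (auto simp: v_def)
      moreover have "2048 * 4 ^ j * (1 / a\<^sup>2) * v = 256 * (s * s * (s * s)) * b\<^sup>2 / s"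
      proof -
        have "(4::real) ^ j = s * s * (s * s)" unfolding ss by (simp flip: power_mult_distrib)
        then show ?thesis using a by (simp add: v_def)
      qed
      moreover have "256 * (s * s * (s * s)) * b\<^sup>2 / s = 256 * (s * s) * b\<^sup>2 * s"
        using s1 by simp
      moreover have "real N = 64 * (s * s) * b\<^sup>2" unfolding ss by (simp add: N_def mb)
      moreover have "64 * (s * s) * b\<^sup>2 < 256 * (s * s) * b\<^sup>2" using s1 b_ge_1 by simp
      moreover have "256 * (s * s) * b\<^sup>2 * 1 \<le> 256 * (s * s) * b\<^sup>2 * s" using s1 by (intro mult_left_mono) auto
      ultimately show ?thesis by linarith
    qed
  qed (use p in auto)
  also have "\<dots> \<le> exp (2 * 2 ^ j * (p * b\<^sup>2)) * exp (- 6 * 2 ^ j * (p * b\<^sup>2))"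
  proof (rule mult_mono)
    have "real k \<le> 12 + 2 * real j + l"
      using l_ge_1 by (simp add: k_def) linarith
    also have "\<dots> \<le> 13 * (1 + real j / 3) * l"
    proof -
      have "(12 + 2 * real j) * 1 \<le> (12 + 13 * real j / 3) * l"
        using l_ge_1 by (intro mult_mono) auto
      then show ?thesis by (simp add: algebra_simps)
    qed
    also have "\<dots> \<le> 13 * s * l"
      using sqrt_2_power_ge[of j] l_ge_1 by (intro mult_right_mono mult_left_mono) (auto simp: s_def)
    finally have "real k \<le> 13 * s * l" .
    then have "real (120 * k) \<le> 120 * (13 * s * l)" by linarith
    then have "120 * k * sqrt N \<le> 120 * (13 * s * l) * (8 * s * b)"
      unfolding sqrt_N by (rule mult_right_mono) (use s1 b_ge_1 in auto)
    also have "\<dots> = 12480 * (s * s) * l * b" by simp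
    finally have "120 * k * sqrt N * ln 4 \<le> 12480 * (s * s) * l * b * 2"
    proof (rule mult_mono)
      have "ln (4::real) = 2 * ln 2" using ln_realpow[of 2 2] by simp
      then show "ln (4::real) \<le> 2" using ln_2_less_1 by simp
    qed (use s1 l_ge_1 b_ge_1 in auto)
    also have "\<dots> \<le> 2 * 2 ^ j * (10 ^ 6 * l * b)"
      unfolding ss using l_ge_1 b_ge_1 by simp
    also have "\<dots> \<le> 2 * 2 ^ j * (p * b\<^sup>2)"
      by (intro mult_left_mono large_pb2) simp
    finally show "4 powr (120 * k * sqrt N) \<le> exp (2 * 2 ^ j * (p * b\<^sup>2))"
      by (simp add: powr_def)
    have "\<rho> \<le> exp (- 3 * p / 4)"
    proof -
      have "1 - p \<le> (1 - 3 * p / 4) * (1 - p / 4)" by (simp add: algebra_simps)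
      also have "\<dots> \<le> exp (- 3 * p / 4) * (1 - p / 4)"
        using p exp_ge_add_one_self[of "- 3 * p / 4"] by (intro mult_right_mono) auto
      finally show ?thesis using p by (simp add: \<rho>_def divide_le_eq)
    qed
    then have "\<rho> ^ n \<le> exp (- 3 * p / 4) ^ n"
      using \<rho> by (intro power_mono) auto
    also have "\<dots> = exp (n * (- 3 * p / 4))" by (rule exp_of_nat_mult[symmetric])
    also have "n * (- 3 * p / 4) = - 6 * 2 ^ j * (p * b\<^sup>2)"
      by (simp add: n_def mb)
    finally show "\<rho> ^ n \<le> exp (- 6 * 2 ^ j * (p * b\<^sup>2))" .
  qed (use \<rho> in auto)
  also have "\<dots> = exp (- 4 * 2 ^ j * (p * b\<^sup>2))"
    by (simp add: exp_add[symmetric])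
  finally have "\<P>(\<omega> in random_subset_space p {1..}. v \<le> card ({N div 2<..N} - (selected {1..} \<omega> + selected {1..} \<omega>)))
      \<le> exp (- 4 * 2 ^ j * (p * b\<^sup>2))" .
  moreover have "N div 2 = 2 ^ j * (32 * m)" by (simp add: N_def)
  ultimately show ?thesis
    by (simp only: N_def[symmetric] v_def[symmetric] s_def[symmetric])
qed

lemma pb2_ge: "10 ^ 6 \<le> p * b\<^sup>2"
proof -
  have "10 ^ 6 * 1 * 1 \<le> 10 ^ 6 * l * b"
    using l_ge_1 b_ge_1 by (intro mult_mono) auto
  then show ?thesis using large_pb2 by simp
qed

lemma sum_dyadic_bound: "(\<Sum>j<J. exp (- 4 * 2 ^ j * (p * b\<^sup>2))) \<le> exp (- p * b\<^sup>2) / 8"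
proof -
  have "exp (- 4 * 2 ^ j * (p * b\<^sup>2)) \<le> exp (- p * b\<^sup>2) / 16 * (1 / 2) ^ j" for j :: nat
  proof -
    have "real (j + 1) \<le> 2 ^ j"
      by (induction j) auto
    define X where "X = 2 ^ j * (p * b\<^sup>2)"
    \<comment> \<open>The huge \<open>p * m\<close> leaves room for a factor
      \<open>2 ^ (j + 4)\<close>, which makes the sum geometric.\<close>
    have "real (j + 4) \<le> real (j + 1) * (p * b\<^sup>2)"
    proof -
      have "real (j + 4) \<le> real (j + 1) * 4" by simp
      also have "\<dots> \<le> real (j + 1) * (p * b\<^sup>2)"
        using pb2_ge by (intro mult_left_mono) auto
      finally show ?thesis .
    qed
    also have "real (j + 1) * (p * b\<^sup>2) \<le> X"
      unfolding X_def using \<open>real (j + 1) \<le> 2 ^ j\<close> p by (intro mult_right_mono) auto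
    finally have "real (j + 4) \<le> X" .
    moreover have "1 * (p * b\<^sup>2) \<le> X"
      unfolding X_def using p by (intro mult_right_mono) auto
    moreover have "0 \<le> p * b\<^sup>2" using p by simp
    ultimately have "- 4 * X \<le> - (p * b\<^sup>2) - real (j + 4)"
      by linarith
    then have "- 4 * 2 ^ j * (p * b\<^sup>2) \<le> - p * b\<^sup>2 + real (j + 4) * - 1"
      by (simp add: X_def)
    then have "exp (- 4 * 2 ^ j * (p * b\<^sup>2)) \<le> exp (- p * b\<^sup>2 + real (j + 4) * - 1)"
      by simp
    also have "\<dots> = exp (- p * b\<^sup>2) * exp (- 1) ^ (j + 4)"
      by (simp only: exp_add exp_of_nat_mult)
    also have "\<dots> \<le> exp (- p * b\<^sup>2) * (1 / 2) ^ (j + 4)"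
    proof (intro mult_left_mono power_mono)
      show "exp (- 1) \<le> (1 / 2 :: real)"
        using exp_ge_add_one_self[of "1 :: real"] by (simp add: exp_minus field_simps)
    qed auto
    also have "\<dots> = exp (- p * b\<^sup>2) / 16 * (1 / 2) ^ j"
      by (simp add: power_add power_divide)
    finally show ?thesis .
  qed
  then have "(\<Sum>j<J. exp (- 4 * 2 ^ j * (p * b\<^sup>2))) \<le> (\<Sum>j<J. exp (- p * b\<^sup>2) / 16 * (1 / 2) ^ j)"
    by (rule sum_mono)
  also have "\<dots> = exp (- p * b\<^sup>2) / 16 * (\<Sum>j<J. (1 / 2) ^ j)"
    by (simp add: sum_distrib_left)
  also have "\<dots> \<le> exp (- p * b\<^sup>2) / 16 * 2"
  proof (rule mult_left_mono)
    have "(\<Sum>j<J. (1 / 2 :: real) ^ j) \<le> (\<Sum>j. (1 / 2) ^ j)"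
      by (intro sum_le_suminf summable_geometric) auto
    then show "(\<Sum>j<J. (1 / 2 :: real) ^ j) \<le> 2"
      by (simp add: suminf_geometric)
  qed simp
  finally show ?thesis by simp
qed

text \<open>The tail starts beyond \<open>32 * m / p\<close>, so the union bound decays like
  \<open>exp (- 16 * p * m)\<close>; this absorbs the factor \<open>1 / p\<^sup>2\<close>, which is
  at most \<open>m\<close>.\<close>

lemma tail_bound:
  assumes J: "1 \<le> 2 ^ J * p"
  shows "\<P>(\<omega> in random_subset_space p {1..}.
      \<exists>y>2 ^ J * (32 * m). y \<notin> selected {1..} \<omega> + selected {1..} \<omega>) \<le> exp (- p * b\<^sup>2) / 8"
proof -
  define q where "q = 2 ^ J * (16 * m)"
  have mb: "real m = b\<^sup>2" using b_sq by (simp add: power2_eq_square)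
  have q: "2 ^ J * (32 * m) = 2 * q" by (simp add: q_def)
  have "\<P>(\<omega> in random_subset_space p {1..}. \<exists>y>2 ^ J * (32 * m). y \<notin> selected {1..} \<omega> + selected {1..} \<omega>)
      \<le> 2 * (1 - p\<^sup>2) ^ q / p\<^sup>2"
    unfolding q using p by (intro prob_tail_missing) auto
  also have "\<dots> \<le> 2 * exp (- 16 * (p * b\<^sup>2)) * b\<^sup>2"
  proof -
    have "(1 - p\<^sup>2) ^ q \<le> exp (- p\<^sup>2) ^ q"
      using p exp_ge_add_one_self[of "- p\<^sup>2"] by (intro power_mono) (auto simp: power_le_one_iff)
    also have "\<dots> = exp (q * (- p\<^sup>2))" by (rule exp_of_nat_mult[symmetric])
    also have "\<dots> \<le> exp (- 16 * (p * b\<^sup>2))"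
    proof -
      have "1 * (16 * (p * b\<^sup>2)) \<le> (2 ^ J * p) * (16 * (p * b\<^sup>2))"
        using J p by (intro mult_right_mono) auto
      then show ?thesis by (simp add: q_def mb power2_eq_square algebra_simps)
    qed
    finally have 1: "(1 - p\<^sup>2) ^ q \<le> exp (- 16 * (p * b\<^sup>2))" .
    have "1 \<le> p * b"
    proof -
      have "a ^ 3 \<le> 1" using a a_le_1 by (intro power_le_one) auto
      then have "p * (a ^ 3 * b) \<le> p * (1 * b)" using p b_ge_1 by (intro mult_left_mono mult_right_mono) auto
      then show ?thesis using large l_ge_1 by simp
    qed
    then have "1 * 1 \<le> (p * b) * (p * b)" by (intro mult_mono) auto
    then have "1 / p\<^sup>2 \<le> b\<^sup>2" using p by (simp add: field_simps power2_eq_square)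
    then have "2 * (1 - p\<^sup>2) ^ q * (1 / p\<^sup>2) \<le> 2 * exp (- 16 * (p * b\<^sup>2)) * b\<^sup>2"
      using 1 p by (intro mult_mono) (auto simp: power_le_one)
    then show ?thesis by simp
  qed
  also have "\<dots> \<le> exp (- p * b\<^sup>2) / 8"
  proof -
    have "b \<le> p * b\<^sup>2"
    proof -
      have "1 * b \<le> 10 ^ 6 * l * b" using l_ge_1 b_ge_1 by (intro mult_right_mono) auto
      then show ?thesis using large_pb2 by simp
    qed
    then have "b\<^sup>2 \<le> (p * b\<^sup>2)\<^sup>2" using b_ge_1 by (intro power_mono) auto
    also have "16 * (p * b\<^sup>2)\<^sup>2 \<le> (15 * (p * b\<^sup>2))\<^sup>2 / 2" by (simp add: power_mult_distrib)
    also have "\<dots> \<le> exp (15 * (p * b\<^sup>2))"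
      using exp_lower_Taylor_quadratic[of "15 * (p * b\<^sup>2)"] p 
      by (smt (verit) mult_nonneg_nonneg zero_le_power2)
    finally have "16 * b\<^sup>2 \<le> exp (15 * (p * b\<^sup>2))" by simp
    then have "exp (- 16 * (p * b\<^sup>2)) * (16 * b\<^sup>2) \<le> exp (- 16 * (p * b\<^sup>2)) * exp (15 * (p * b\<^sup>2))"
      by (intro mult_left_mono) auto
    also have "\<dots> = exp (- p * b\<^sup>2)" by (simp add: exp_add[symmetric])
    finally show ?thesis by simp
  qed
  finally show ?thesis .
qed

text \<open>If no exceptional event occurs, fewer than \<open>(1 - \<epsilon>/2) * m\<close> sums
  are missing up to \<open>32 * m\<close>, at most \<open>\<epsilon> * m / 2\<close> in the blocks,
  and none beyond.\<close>

lemma sumset_complement_bound: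
  "\<P>(\<omega> in random_subset_space p {1::nat..}. card_at_least m ({1..} - (selected {1..} \<omega> + selected {1..} \<omega>)))
    < (1 - p) powr (real m / 2 - a\<^sup>2 * real m)"
proof -
  let ?S = "random_subset_space p {1::nat..}"
  let ?A = "\<lambda>\<omega>. selected {1::nat..} \<omega> + selected {1..} \<omega>"
  define r where "r = (1 - p) powr (real m / 2 - a\<^sup>2 * real m)"
  have r: "0 < r" "exp (- p * b\<^sup>2) \<le> r"
    using p target_ge by (auto simp: r_def)
  have mb: "real m = b\<^sup>2" using b_sq by (simp add: power2_eq_square)
  \<comment> \<open>Minimality gives \<open>2 ^ j * p \<le> 1\<close> for every block, while
    \<open>J\<close> itself meets the condition for the tail.\<close>
  define J where "J = (LEAST J. 1 \<le> 2 ^ J * p)"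
  obtain J' where "1 / p < 2 ^ J'" using real_arch_pow[of 2 "1 / p"] by auto
  then have "1 \<le> 2 ^ J' * p" using p by (simp add: field_simps)
  then have J: "1 \<le> 2 ^ J * p" unfolding J_def by (rule LeastI)
  have J_least: "2 ^ j * p \<le> 1" if "j < J" for j
    using not_less_Least[of j "\<lambda>J. 1 \<le> 2 ^ J * p"] that unfolding J_def by simp
  define E where "E = {\<omega> \<in> space ?S. (1 - a\<^sup>2 / 2) * m \<le> card ({1..32 * m} - ?A \<omega>)}"
  define B where "B = (\<lambda>j. {\<omega> \<in> space ?S. a\<^sup>2 * b\<^sup>2 / 8 / sqrt 2 ^ j \<le>
      card ({2 ^ j * (32 * m)<..2 ^ Suc j * (32 * m)} - ?A \<omega>)})"
  define T where "T = {\<omega> \<in> space ?S. \<exists>y>2 ^ J * (32 * m). y \<notin> ?A \<omega>}"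
  have EBT [measurable]: "E \<in> sets ?S" "B j \<in> sets ?S" "T \<in> sets ?S" for j
    unfolding E_def B_def T_def by (simp_all add: sets_card_missing)
  have "{\<omega> \<in> space ?S. card_at_least m ({1..} - ?A \<omega>)} \<subseteq> E \<union> ((\<Union>j<J. B j) \<union> T)"
  proof (rule subsetI, rule ccontr)
    fix \<omega> assume "\<omega> \<in> {\<omega> \<in> space ?S. card_at_least m ({1..} - ?A \<omega>)}" "\<omega> \<notin> E \<union> ((\<Union>j<J. B j) \<union> T)"
    then have large: "card_at_least m ({1..} - ?A \<omega>)"
      and nE: "card ({1..32 * m} - ?A \<omega>) < (1 - a\<^sup>2 / 2) * m"
      and nB: "\<And>j. j < J \<Longrightarrow> card ({2 ^ j * (32 * m)<..2 ^ Suc j * (32 * m)} - ?A \<omega>) < a\<^sup>2 * b\<^sup>2 / 8 / sqrt 2 ^ j"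
      and nT: "\<And>y. 2 ^ J * (32 * m) < y \<Longrightarrow> y \<in> ?A \<omega>"
      unfolding E_def B_def T_def by (auto simp: not_le)
    \<comment> \<open>The missing set is therefore finite, which rules out the infinite case of
      \<open>card_at_least\<close>.\<close>
    have eq: "{1..} - ?A \<omega> = {1..2 ^ J * (32 * m)} - ?A \<omega>"
    proof -
      have "y \<le> 2 ^ J * (32 * m)" if "y \<notin> ?A \<omega>" for y
        using nT[of y] that by (meson not_le)
      then show ?thesis by auto
    qed
    have "real (card ({1..2 ^ J * (32 * m)} - ?A \<omega>))
        \<le> real (card ({1..32 * m} - ?A \<omega>)) + (\<Sum>j<J. real (card ({2 ^ j * (32 * m)<..2 ^ Suc j * (32 * m)} - ?A \<omega>)))"
      using card_missing_dyadic_le[of J "32 * m" "?A \<omega>"] by (simp only: of_nat_le_iff flip: of_nat_add of_nat_sum)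
    also have "\<dots> < (1 - a\<^sup>2 / 2) * m + (\<Sum>j<J. a\<^sup>2 * b\<^sup>2 / 8 / sqrt 2 ^ j)"
      using nE nB by (intro add_less_le_mono sum_mono) (auto intro: less_imp_le)
    also have "(\<Sum>j<J. a\<^sup>2 * b\<^sup>2 / 8 / sqrt 2 ^ j) = a\<^sup>2 * b\<^sup>2 / 8 * (\<Sum>j<J. 1 / sqrt 2 ^ j)"
      by (simp add: sum_distrib_left)
    also have "(1 - a\<^sup>2 / 2) * m + \<dots> \<le> (1 - a\<^sup>2 / 2) * m + a\<^sup>2 * b\<^sup>2 / 8 * 4"
      by (intro add_left_mono mult_left_mono sum_inverse_sqrt_2_le) auto
    also have "\<dots> = m" by (simp add: mb algebra_simps)
    finally have "card ({1..2 ^ J * (32 * m)} - ?A \<omega>) < m" by simp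
    then show False
      using large unfolding eq card_at_least_def by simp
  qed
  then have "measure ?S {\<omega> \<in> space ?S. card_at_least m ({1..} - ?A \<omega>)} \<le> measure ?S (E \<union> ((\<Union>j<J. B j) \<union> T))"
    by (intro random_subset.finite_measure_mono) measurable
  also have "\<dots> \<le> measure ?S E + measure ?S ((\<Union>j<J. B j) \<union> T)"
    by (rule measure_Un_le) measurable
  also have "\<dots> \<le> measure ?S E + (measure ?S (\<Union>j<J. B j) + measure ?S T)"
    by (intro add_left_mono measure_Un_le) measurable
  also have "\<dots> \<le> measure ?S E + ((\<Sum>j<J. measure ?S (B j)) + measure ?S T)"
    by (intro add_left_mono add_right_mono measure_UNION_le finite_lessThan EBT)
  also have "\<dots> \<le> r / 4 + ((\<Sum>j<J. exp (- 4 * 2 ^ j * (p * b\<^sup>2))) + exp (- p * b\<^sup>2) / 8)"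
  proof (intro add_mono sum_mono)
    show "measure ?S E \<le> r / 4" unfolding E_def r_def by (rule initial_bound)
    show "measure ?S (B j) \<le> exp (- 4 * 2 ^ j * (p * b\<^sup>2))" if "j \<in> {..<J}" for j
      unfolding B_def using that J_least by (intro dyadic_bound) auto
    show "measure ?S T \<le> exp (- p * b\<^sup>2) / 8" unfolding T_def by (rule tail_bound[OF J])
  qed
  \<comment> \<open>The three contributions are at most \<open>r / 4\<close>, \<open>r / 8\<close>
    and \<open>r / 8\<close>.\<close>
  also have "\<dots> < r"
    using sum_dyadic_bound[of J] r by linarith
  finally show ?thesis unfolding r_def .
qed

end

theorem theorem1p1:
  shows "\<exists>C::real. C > 1 \<and>
    (\<forall>(m::nat) (\<epsilon>::real) (p::real).
       m \<ge> 1 \<longrightarrow> \<epsilon> > 0 \<longrightarrow> p > 0 \<longrightarrow>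
       C * log 2 (1 / \<epsilon>) / sqrt (\<epsilon> ^ 3 * real m) \<le> p \<longrightarrow> p \<le> 1 / 2 \<longrightarrow>
       \<P>(\<omega> in random_subset_space p {1::nat..}.
           card_at_least m ({1..} - (selected {1..} \<omega> + selected {1..} \<omega>)))
         < (1 - p) powr (real m / 2 - \<epsilon> * real m))"
proof (intro exI[of _ "10 ^ 6"] conjI allI impI)
  fix m :: nat and \<epsilon> p :: real
  assume m: "m \<ge> 1" and \<epsilon>: "\<epsilon> > 0" and p: "p > 0" "p \<le> 1 / 2"
    and large: "10 ^ 6 * log 2 (1 / \<epsilon>) / sqrt (\<epsilon> ^ 3 * real m) \<le> p"
  show "\<P>(\<omega> in random_subset_space p {1::nat..}.
           card_at_least m ({1..} - (selected {1..} \<omega> + selected {1..} \<omega>)))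
         < (1 - p) powr (real m / 2 - \<epsilon> * real m)"
  proof (cases "\<epsilon> \<le> 1 / 2")
    case True
    have "sqrt (\<epsilon> ^ 3 * real m) = sqrt \<epsilon> ^ 3 * sqrt m"
      by (simp add: real_sqrt_mult real_sqrt_power)
    moreover have "0 < sqrt (\<epsilon> ^ 3 * real m)" using \<epsilon> m by simp
    ultimately have "10 ^ 6 * log 2 (1 / \<epsilon>) \<le> p * (sqrt \<epsilon> ^ 3 * sqrt m)"
      using large by (simp add: pos_divide_le_eq)
    then interpret sumset_parameters m p "sqrt \<epsilon>" "sqrt m" "log 2 (1 / \<epsilon>)"
      using True \<epsilon> p m by unfold_locales auto
    have "(sqrt \<epsilon>)\<^sup>2 = \<epsilon>" using \<epsilon> by simp
    then show ?thesis using sumset_complement_bound by (simp only:)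
  next
    \<comment> \<open>For \<open>\<epsilon> > 1/2\<close> the exponent is negative, so the bound
      exceeds 1.\<close>
    case False
    then have "1 / 2 * real m < \<epsilon> * real m" using m by (intro mult_strict_right_mono) auto
    then have "(real m / 2 - \<epsilon> * real m) * ln (1 - p) > 0"
      using p by (intro mult_neg_neg) auto
    then have "1 < (1 - p) powr (real m / 2 - \<epsilon> * real m)"
      using p by (simp add: powr_def)
    then show ?thesis
      using random_subset.prob_le_1 by (rule le_less_trans[rotated])
  qed
qed simp

end
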